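(* Let $\zeta\in[0,\infty)$ and $\alpha\in(0,2)$. There is a constant $C>0$ depending only on $\zeta$ and $\alpha$ such that for all $r,s,z,t,\tau>0$, \[ \min\Big\{\Big(\frac{r+z}{r+s+z}\Big)^{2\zeta}p_\zeta^{(\alpha)}(t,r,z),\ \Big(\frac{s+z}{r+s+z}\Big)^{2\zeta}p_\zeta^{(\alpha)}(\tau,z,s)\Big\}\le C\,p_\zeta^{(\alpha)}(t+\tau,r,s), \] and \[ p_\zeta^{(\alpha)}(t,r,z)\,p_\zeta^{(\alpha)}(\tau,z,s)\le C\,p_\zeta^{(\alpha)}(t+\tau,r,s)\Big[\Big(\frac{r+s+z}{s+z}\Big)^{2\zeta}p_\zeta^{(\alpha)}(t,r,z)+\Big(\frac{r+s+z}{r+z}\Big)^{2\zeta}p_\zeta^{(\alpha)}(\tau,z,s)\Big]. \]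
   Context: For $\nu\in\mathbb{C}$, $I_\nu$ is the modified Bessel function of the first kind. For $\zeta\in(-1/2,\infty)$, $p_\zeta^{(2)}(t,r,s):=\frac{(rs)^{1/2-\zeta}}{2t}\exp\big(-\frac{r^2+s^2}{4t}\big)I_{\zeta-1/2}\big(\frac{rs}{2t}\big)$ for $r,s,t>0$. For $\alpha\in(0,2)$ and $t>0$, $\sigma_t^{(\alpha/2)}$ is the probability density on $(0,\infty)$ with $e^{-t\lambda^{\alpha/2}}=\int_0^\infty e^{-\tau\lambda}\sigma_t^{(\alpha/2)}(\tau)\,d\tau$ for $\lambda\ge0$, and $p_\zeta^{(\alpha)}(t,r,s):=\int_0^\infty p_\zeta^{(2)}(\tau,r,s)\sigma_t^{(\alpha/2)}(\tau)\,d\tau$. *)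

theory Defs
  imports "HOL-Analysis.Analysis"
begin

definition besselI :: "real \<Rightarrow> real \<Rightarrow> real" where
  "besselI nu x = (\<Sum>k. (x / 2) powr (2 * real k + nu) / (fact k * Gamma (real k + nu + 1)))"

definition p2 :: "real \<Rightarrow> real \<Rightarrow> real \<Rightarrow> real \<Rightarrow> real" where
  "p2 zeta t r s = (r * s) powr (1/2 - zeta) / (2 * t) * exp (- (r^2 + s^2) / (4 * t))
                    * besselI (zeta - 1/2) (r * s / (2 * t))"

text \<open>dens is a probability density on (0,infinity) whose Laplace transform is
  exp(- t lambda^(alpha/2)) (the alpha/2-stable subordinator density at time t).\<close>
definition stable_density :: "real \<Rightarrow> real \<Rightarrow> (real \<Rightarrow> real) \<Rightarrow> bool" where
  "stable_density alpha t dens \<longleftrightarrow>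
     dens \<in> borel_measurable lborel \<and>
     (\<forall>u>0. 0 \<le> dens u) \<and>
     set_integrable lborel {0<..} dens \<and>
     (LINT u:{0<..}|lborel. dens u) = 1 \<and>
     (\<forall>lam\<ge>0. exp (- t * lam powr (alpha / 2)) = (LINT u:{0<..}|lborel. exp (- u * lam) * dens u))"

definition p_alpha :: "(real \<Rightarrow> real \<Rightarrow> real) \<Rightarrow> real \<Rightarrow> real \<Rightarrow> real \<Rightarrow> real \<Rightarrow> real" where
  "p_alpha dens zeta t r s = (LINT u:{0<..}|lborel. p2 zeta u r s * dens t u)"

end

theory Submission
  imports Defs "HOL-Probability.Probability_Measure" "HOL-Real_Asymp.Real_Asymp"
begin

text \<open>
  The kernel of order \<open>alpha\<close> is comparable, with constants depending only on \<open>zeta\<close> and \<open>alpha\<close>, to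
  \<open>t / (M powr (1 + alpha) * (r + s + T) powr (2 * zeta))\<close>, where \<open>T = t powr (1 / alpha)\<close> and
  \<open>M = max \<bar>r - s\<bar> T\<close>. For this expression the inequality for the minimum is elementary: the
  space-time distance \<open>M\<close> satisfies a quasi-triangle inequality, so the factor with the larger distance
  is the one to keep. The product inequality then follows by cross-multiplication.

  The two-sided bound does not need pointwise information on the stable density. The Gaussian-type kernel
  is comparable to \<open>u powr (- 1/2) * exp (- (r - s)^2 / (4 * u)) * (u + r * s) powr - zeta\<close>, and
  its averages over \<open>u\<close> are controlled by pointwise comparison with the functions \<open>exp (- u * lam)\<close>
  and \<open>1 - exp (- u * lam)\<close>, whose means are given by the Laplace transform.
\<close>

subsection \<open>Modified Bessel functions\<close>

text \<open>The constant is chosen before \<open>dens\<close>, so every estimate has to be uniform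
  over all laws with the given Laplace transform, and in \<open>t\<close>. Testing at
  \<open>lam = x / m^2\<close> leaves \<open>t * m powr - alpha\<close> as the only parameter. This
  explains the power \<open>1 + alpha\<close>: a Gaussian at distance \<open>m\<close> lives on
  times \<open>u\<close> of order \<open>m^2\<close>, where its height is of order
  \<open>1 / m\<close>, and for \<open>t \<le> m powr alpha\<close> the law gives such times a mass
  of order \<open>t * m powr - alpha\<close>.

  For the kernel of order two the reference point is order -1/2, where the Bessel function is a
  multiple of \<open>cosh x / sqrt x\<close>. Passing to \<open>zeta - 1/2\<close> changes the terms
  of the \<open>cosh\<close> series by a factor comparable to \<open>(k + 1) powr - zeta\<close>.
  The weights \<open>x ^ (2*k) / fact (2*k)\<close> concentrate around \<open>k = x / 2\<close>, so
  the sum changes by a factor of order \<open>(1 + x) powr - zeta\<close>.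

  The resulting \<open>u + r * s\<close> is much smaller than \<open>u + (r + s)^2\<close> only if
  \<open>r\<close> and \<open>s\<close> are far apart relative to \<open>sqrt u\<close>, and there
  the Gaussian compensates.\<close>

lemma positive_convergent_bounds:
  fixes g :: "nat \<Rightarrow> real"
  assumes pos: "\<And>n. 0 < g n" and lim: "g \<longlonglongrightarrow> l" and l: "0 < l"
  obtains c C where "0 < c" "0 < C" "\<And>n. c \<le> g n" "\<And>n. g n \<le> C"
proof -
  have "Bseq g" using lim by (auto intro: convergent_imp_Bseq convergentI)
  then obtain C where C: "0 < C" "\<And>n. norm (g n) \<le> C" by (auto elim: BseqE)
  have "(\<lambda>n. inverse (g n)) \<longlonglongrightarrow> inverse l" using lim l by (intro tendsto_inverse) auto
  then have "Bseq (\<lambda>n. inverse (g n))" by (auto intro: convergent_imp_Bseq convergentI)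
  then obtain K where K: "0 < K" "\<And>n. norm (inverse (g n)) \<le> K" by (auto elim: BseqE)
  show thesis
  proof (rule that[of "inverse K" C])
    fix n
    have "inverse (g n) \<le> K" using K(2)[of n] pos[of n] by simp
    then show "inverse K \<le> g n" using pos[of n] K(1) by (simp add: field_simps)
    show "g n \<le> C" using C(2)[of n] by simp
  qed (use C K in auto)
qed

text \<open>The quotient of the two sides is positive for every \<open>k\<close> and tends to 1,
  hence lies between positive constants. The limit is read off from the approximants
  \<open>Gamma_series'\<close> at \<open>1/2\<close> and \<open>zeta + 1/2\<close>, in whose
  quotient the factorials cancel.\<close>

lemma Gamma_ratio_bounds:
  fixes zeta :: real
  assumes z: "0 \<le> zeta"
  obtains c C where "0 < c" "0 < C"
    "\<And>k. c * ((real k + 1) powr zeta * Gamma (real k + 1/2)) \<le> Gamma (real k + zeta + 1/2)"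
    "\<And>k. Gamma (real k + zeta + 1/2) \<le> C * ((real k + 1) powr zeta * Gamma (real k + 1/2))"
proof -
  define g where "g k = Gamma (real k + zeta + 1/2) / ((real k + 1) powr zeta * Gamma (real k + 1/2))" for k
  have np: "zeta + 1/2 \<notin> \<int>\<^sub>\<le>\<^sub>0" "(1/2::real) \<notin> \<int>\<^sub>\<le>\<^sub>0"
    using z by (auto elim!: nonpos_Ints_cases)
  have pos: "0 < g k" for k
    unfolding g_def using z by (intro divide_pos_pos mult_pos_pos Gamma_real_pos) auto
  have L: "(\<lambda>n. Gamma_series' (1/2::real) n / Gamma_series' (zeta + 1/2) n) \<longlonglongrightarrow> Gamma (1/2) / Gamma (zeta + 1/2)"
    using np by (intro tendsto_divide Gamma_series'_LIMSEQ) (auto simp: Gamma_eq_zero_iff)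
  \<comment> \<open>This factor turns \<open>n powr zeta\<close> into
    \<open>(n + 1) powr zeta\<close>, the form that stays positive at index 0.\<close>
  have R: "(\<lambda>n. (real n / (real n + 1)) powr zeta) \<longlonglongrightarrow> 1"
  proof -
    have "(\<lambda>n. (real n / (real n + 1))) \<longlonglongrightarrow> 1" by real_asymp
    then have "(\<lambda>n. (real n / (real n + 1)) powr zeta) \<longlonglongrightarrow> 1 powr zeta"
      by (intro tendsto_powr) auto
    then show ?thesis by simp
  qed
  have "(\<lambda>n. Gamma (zeta + 1/2) / Gamma (1/2) * (Gamma_series' (1/2::real) n / Gamma_series' (zeta + 1/2) n)
          * (real n / (real n + 1)) powr zeta) \<longlonglongrightarrow> Gamma (zeta + 1/2) / Gamma (1/2) * (Gamma (1/2) / Gamma (zeta + 1/2)) * 1"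
    by (intro tendsto_mult tendsto_const L R)
  also have "Gamma (zeta + 1/2) / Gamma (1/2) * (Gamma (1/2) / Gamma (zeta + 1/2)) * 1 = 1"
    using np by (auto simp: Gamma_eq_zero_iff)
  finally have lim': "(\<lambda>n. Gamma (zeta + 1/2) / Gamma (1/2) * (Gamma_series' (1/2::real) n / Gamma_series' (zeta + 1/2) n)
          * (real n / (real n + 1)) powr zeta) \<longlonglongrightarrow> 1" .
  have "g \<longlonglongrightarrow> 1"
  proof (rule Lim_transform_eventually[OF lim'])
    show "\<forall>\<^sub>F n in sequentially. Gamma (zeta + 1/2) / Gamma (1/2) * (Gamma_series' (1/2::real) n / Gamma_series' (zeta + 1/2) n)
          * (real n / (real n + 1)) powr zeta = g n"
      using eventually_gt_at_top[of 0]
    proof eventually_elim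
      case (elim n)
      have e: "exp (a * ln (real n)) = real n powr a" for a using elim by (simp add: powr_def)
      have G0: "Gamma (zeta + 1/2) \<noteq> 0" "Gamma (1/2::real) \<noteq> 0" "Gamma (real n + 1/2) \<noteq> 0" 
        using np z Gamma_real_pos[of "real n + 1/2"] by (auto simp: Gamma_eq_zero_iff)
      have G1: "Gamma (real n + zeta + 1/2) \<noteq> 0"
        using Gamma_real_pos[of "real n + zeta + 1/2"] z by (intro less_imp_neq[THEN not_sym]) auto
      have s: "real n powr (zeta + 1/2) = real n powr zeta * real n powr (1/2)" by (rule powr_add)
      have d: "(real n / (real n + 1)) powr zeta = real n powr zeta / (real n + 1) powr zeta"
        by (simp add: powr_divide)
      have q1: "pochhammer (zeta + 1/2) n = Gamma (real n + zeta + 1/2) / Gamma (zeta + 1/2)"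
        using pochhammer_Gamma[OF np(1), of n] by (simp add: algebra_simps)
      have q2: "pochhammer (1/2) n = Gamma (real n + 1/2) / Gamma (1/2::real)"
        using pochhammer_Gamma[OF np(2), of n] by (simp add: algebra_simps)
      have f0: "(fact (n - 1) :: real) \<noteq> 0" by simp
      define G1 G2 G3 G4 X Y Z F where v: "G1 = Gamma (zeta + 1/2)" "G2 = Gamma (1/2::real)"
         "G3 = Gamma (real n + 1/2)" "G4 = Gamma (real n + zeta + 1/2)"
         "X = real n powr zeta" "Y = real n powr (1/2)" "Z = (real n + 1) powr zeta" "F = (fact (n - 1) :: real)"
      have nz: "G1 \<noteq> 0" "G2 \<noteq> 0" "G3 \<noteq> 0" "G4 \<noteq> 0" "X \<noteq> 0" "Y \<noteq> 0" "Z \<noteq> 0" "F \<noteq> 0"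
        using G0 G1 elim f0 by (auto simp: v)
      show ?case
        unfolding Gamma_series'_def g_def of_real_eq_id id_apply e s d q1 q2 v[symmetric]
        using nz by (simp add: field_simps)
    qed
  qed
  from positive_convergent_bounds[of g, OF pos this] obtain c C
    where cC: "0 < c" "0 < C" "\<And>n. c \<le> g n" "\<And>n. g n \<le> C" by auto
  have den: "0 < (real k + 1) powr zeta * Gamma (real k + 1/2)" for k
    by (intro mult_pos_pos Gamma_real_pos) auto
  show thesis
  proof (rule that[OF cC(1,2)])
    fix k
    show "c * ((real k + 1) powr zeta * Gamma (real k + 1/2)) \<le> Gamma (real k + zeta + 1/2)"
      using cC(3)[of k] den[of k] unfolding g_def by (simp add: pos_le_divide_eq)
    show "Gamma (real k + zeta + 1/2) \<le> C * ((real k + 1) powr zeta * Gamma (real k + 1/2))"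
      using cC(4)[of k] den[of k] unfolding g_def by (simp add: pos_divide_le_eq)
  qed
qed

section \<open>Moments of the hyperbolic cosine series\<close>

lemma cosh_even_sums:
  fixes x :: real
  shows "(\<lambda>k. x ^ (2*k) / fact (2*k)) sums cosh x"
proof -
  have "(\<lambda>n. if even n then x ^ n /\<^sub>R fact n else 0) sums cosh x" by (rule cosh_converges)
  then have "(\<lambda>k. (\<lambda>n. if even n then x ^ n /\<^sub>R fact n else 0) (2*k)) sums cosh x"
    by (subst sums_mono_reindex) (auto simp: strict_mono_def elim!: evenE)
  then show ?thesis by (simp add: divide_inverse mult.commute)
qed

lemma sinh_odd_sums:
  fixes x :: real
  shows "(\<lambda>k. x ^ (2*k+1) / fact (2*k+1)) sums sinh x"
proof -
  have "(\<lambda>n. if even n then 0 else x ^ n /\<^sub>R fact n) sums sinh x" by (rule sinh_converges)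
  then have "(\<lambda>k. (\<lambda>n. if even n then 0 else x ^ n /\<^sub>R fact n) (2*k+1)) sums sinh x"
    by (subst sums_mono_reindex) (auto simp: strict_mono_def elim!: oddE)
  then show ?thesis by (simp add: divide_inverse mult.commute)
qed

text \<open>A factor \<open>2 * k\<close> cancels against \<open>fact (2 * k)\<close> and leaves the
  odd series of \<open>sinh\<close>. After division by \<open>cosh x\<close> the mean of
  \<open>k + 1\<close> is \<open>1 + x / 2 * tanh x\<close>, which is at most \<open>1 + x\<close>
  for \<open>x \<ge> 0\<close>; this is the input to Markov's inequality.\<close>

lemma cosh_weighted_sums:
  fixes x :: real
  shows "(\<lambda>k. x ^ (2*k) / fact (2*k) * (real k + 1)) sums (x / 2 * sinh x + cosh x)"
proof -
  have "(\<lambda>k. x / 2 * (x ^ (2*k+1) / fact (2*k+1))) sums (x / 2 * sinh x)"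
    by (intro sums_mult sinh_odd_sums)
  also have "(\<lambda>k. x / 2 * (x ^ (2*k+1) / fact (2*k+1))) = (\<lambda>k. x ^ (2*Suc k) / fact (2*Suc k) * real (Suc k))"
  proof (rule ext)
    fix k
    have f: "(fact (2 * Suc k) :: real) = (2 * real k + 2) * fact (2 * k + 1)" by simp
    have "(2 * real k + 2) \<noteq> 0" by (smt (verit) of_nat_0_le_iff)
    then show "x / 2 * (x ^ (2*k+1) / fact (2*k+1)) = x ^ (2*Suc k) / fact (2*Suc k) * real (Suc k)"
      unfolding f by (simp add: divide_simps del: fact_Suc)
  qed
  finally have "(\<lambda>k. x ^ (2*k) / fact (2*k) * real k) sums (x / 2 * sinh x)"
    by (subst (asm) sums_Suc_iff) simp
  from sums_add[OF this cosh_even_sums[of x]] show ?thesis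
    by (simp add: distrib_left)
qed

lemma fact_add_le: "(fact (n + m) :: real) \<le> fact n * real (n + m) ^ m"
proof (induction m)
  case (Suc m)
  have "(fact (n + Suc m) :: real) = real (n + Suc m) * fact (n + m)" by simp
  also have "\<dots> \<le> real (n + Suc m) * (fact n * real (n + m) ^ m)"
    by (intro mult_left_mono Suc) auto
  also have "\<dots> \<le> real (n + Suc m) * (fact n * real (n + Suc m) ^ m)"
    by (intro mult_left_mono power_mono) auto
  finally show ?case by (simp add: mult_ac)
qed auto

text \<open>For integer exponents \<^term>\<open>m\<close> the negative moment is a shifted exponential series; other exponents
  are reached through \<^term>\<open>y powr zeta \<le> 1 + y ^ m\<close>.\<close>
lemma cosh_negative_moment_upper:
  fixes zeta :: real
  assumes z: "0 \<le> zeta"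
  obtains C where "0 < C"
    "\<And>x. 0 \<le> x \<Longrightarrow> summable (\<lambda>k. x ^ (2*k) / fact (2*k) * (real k + 1) powr - zeta)"
    "\<And>x. 0 \<le> x \<Longrightarrow> (\<Sum>k. x ^ (2*k) / fact (2*k) * (real k + 1) powr - zeta) \<le> C * (exp x * (1 + x) powr - zeta)"
proof -
  obtain m :: nat where m: "zeta \<le> real m" using real_arch_simple by blast
  define C where "C = 1 + 2 ^ m * (1 + (real m + 2) ^ m)"
  have C: "0 < C" unfolding C_def by (intro add_pos_nonneg) auto
  have w_sum: "summable (\<lambda>k. x ^ (2*k) / fact (2*k))" for x :: real
    using cosh_even_sums by (rule sums_summable)
  have S: "summable (\<lambda>k. x ^ (2*k) / fact (2*k) * (real k + 1) powr - zeta)" if x: "0 \<le> x" for x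
  proof (rule summable_comparison_test'[OF w_sum[of x]])
    fix k :: nat
    have "(real k + 1) powr - zeta \<le> 1" using z by (simp add: powr_minus ge_one_powr_ge_zero inverse_le_1_iff)
    then show "norm (x ^ (2*k) / fact (2*k) * (real k + 1) powr - zeta) \<le> x ^ (2*k) / fact (2*k)"
      using x mult_left_le[of "(real k + 1) powr - zeta" "x ^ (2*k) / fact (2*k)"] by simp
  qed
  have B: "(\<Sum>k. x ^ (2*k) / fact (2*k) * (real k + 1) powr - zeta) \<le> C * (exp x * (1 + x) powr - zeta)"
    if x: "0 \<le> x" for x
  proof -
    define e where "e n = x ^ n / fact n" for n
    have e0: "0 \<le> e n" for n using x by (simp add: e_def)
    have e_sums: "e sums exp x" using exp_converges[of x] by (simp add: e_def[abs_def] divide_inverse mult.commute)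
    have sm: "summable (\<lambda>k. e (2*k+m))" "(\<Sum>k. e (2*k+m)) \<le> exp x"
    proof -
      have i: "inj (\<lambda>k. 2*k+m)" by (auto simp: inj_def)
      show "summable (\<lambda>k. e (2*k+m))"
        using summable_reindex[OF sums_summable[OF e_sums] i e0] by (simp add: o_def)
      show "(\<Sum>k. e (2*k+m)) \<le> exp x"
        using suminf_reindex_mono[OF sums_summable[OF e_sums] i e0] sums_unique[OF e_sums]
        by (simp add: o_def)
    qed
    have s0: "summable (\<lambda>k. e (2*k))" "(\<Sum>k. e (2*k)) \<le> exp x"
    proof -
      have c: "(\<lambda>k. e (2*k)) sums cosh x" unfolding e_def by (rule cosh_even_sums)
      show "summable (\<lambda>k. e (2*k))" using c by (rule sums_summable)
      have "cosh x \<le> exp x" using x by (simp add: cosh_def)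
      then show "(\<Sum>k. e (2*k)) \<le> exp x" using sums_unique[OF c] by simp
    qed
    define A where "A = (1 + 2^m :: real)"
    define K where "K = 2^m * (real m + 2)^m"
    \<comment> \<open>After multiplication by \<open>(1 + x) powr zeta\<close> the target is a bound
      by two subseries of \<open>exp x\<close>: the even one, and the one over the indices
      \<open>2 * k + m\<close>, which absorbs the power \<open>x ^ m\<close>.\<close>
    have summand: "(1 + x) powr zeta * (e (2*k) * (real k + 1) powr - zeta) \<le> A * e (2*k) + K * e (2*k+m)" for k
    proof -
      define y where "y = (1 + x) / (real k + 1)"
      have y: "0 < y" using x by (simp add: y_def)
      have "y powr zeta \<le> 1 + y ^ m"
      proof (cases "y \<le> 1")
        case True
        then have "y powr zeta \<le> 1" using z y by (simp add: powr_le1)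
        then show ?thesis using y by (smt (verit) zero_le_power)
      next
        case False
        then have "y powr zeta \<le> y powr real m" using m by (intro powr_mono) auto
        then show ?thesis using y by (simp add: powr_realpow)
      qed
      moreover have "(1 + x) powr zeta * (real k + 1) powr - zeta = y powr zeta"
        unfolding y_def using x by (subst powr_divide) (simp_all add: powr_minus divide_inverse)
      ultimately have 1: "(1 + x) powr zeta * (e (2*k) * (real k + 1) powr - zeta) \<le> e (2*k) * (1 + y ^ m)"
        using e0[of "2*k"] by (metis mult.left_commute mult_left_mono)
      have "(1 + x) ^ m \<le> 2 ^ m * (1 + x ^ m)"
      proof -
        have "(1 + x) ^ m \<le> (2 * max 1 x) ^ m" using x by (intro power_mono) auto
        also have "\<dots> = 2 ^ m * max 1 x ^ m" by (rule power_mult_distrib)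
        also have "\<dots> \<le> 2 ^ m * (1 + x ^ m)" using x by (intro mult_left_mono) (auto simp: max_def)
        finally show ?thesis .
      qed
      then have "y ^ m \<le> 2 ^ m * (1 + x ^ m) / (real k + 1) ^ m"
        unfolding y_def power_divide by (intro divide_right_mono) auto
      then have "e (2*k) * y ^ m \<le> e (2*k) * (2 ^ m * (1 + x ^ m) / (real k + 1) ^ m)"
        using e0 by (intro mult_left_mono)
      also have "\<dots> = 2 ^ m * (e (2*k) / (real k + 1) ^ m) + 2 ^ m * (e (2*k) * x ^ m / (real k + 1) ^ m)"
        by (simp add: field_simps)
      also have "e (2*k) / (real k + 1) ^ m \<le> e (2*k)"
        using e0[of "2*k"] by (simp add: divide_le_eq mult_le_cancel_left1 one_le_power)
      \<comment> \<open>The power \<open>x ^ m\<close> raises the index to \<open>2 * k + m\<close>;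
        the \<open>m\<close> new factors of the factorial, each at most
        \<open>(m + 2) * (k + 1)\<close>, are paid for by \<open>(k + 1) ^ m\<close>.\<close>
      also have "e (2*k) * x ^ m / (real k + 1) ^ m \<le> (real m + 2) ^ m * e (2*k+m)"
      proof -
        have "(fact (2*k+m) :: real) \<le> fact (2*k) * real (2*k+m) ^ m" by (rule fact_add_le)
        also have "\<dots> \<le> fact (2*k) * ((real m + 2) * (real k + 1)) ^ m"
          by (intro mult_left_mono power_mono) (auto simp: algebra_simps)
        finally have f: "(fact (2*k+m) :: real) \<le> fact (2*k) * ((real m + 2) ^ m * (real k + 1) ^ m)"
          by (simp add: power_mult_distrib)
        have "x ^ (2*k+m) * fact (2*k+m) \<le> x ^ (2*k+m) * (fact (2*k) * ((real m + 2) ^ m * (real k + 1) ^ m))"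
          using f x by (intro mult_left_mono) auto
        then show ?thesis unfolding e_def by (simp add: field_simps power_add)
      qed
      finally have 2: "e (2*k) * y ^ m \<le> 2 ^ m * e (2*k) + 2 ^ m * ((real m + 2) ^ m * e (2*k+m))" by simp
      show ?thesis using 1 2 by (simp add: A_def K_def algebra_simps)
    qed
    have "(1 + x) powr zeta * (\<Sum>k. e (2*k) * (real k + 1) powr - zeta)
        = (\<Sum>k. (1 + x) powr zeta * (e (2*k) * (real k + 1) powr - zeta))"
      using S[OF x] by (intro suminf_mult[symmetric]) (simp add: e_def)
    also have "\<dots> \<le> (\<Sum>k. A * e (2*k) + K * e (2*k+m))"
      using S[OF x] s0 sm by (intro suminf_le summand summable_add summable_mult) (simp_all add: e_def)
    also have "\<dots> = A * (\<Sum>k. e (2*k)) + K * (\<Sum>k. e (2*k+m))"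
      using s0 sm by (subst suminf_add[symmetric]) (auto intro!: summable_mult simp: suminf_mult)
    also have "\<dots> \<le> A * exp x + K * exp x"
      using s0 sm by (intro add_mono mult_left_mono) (auto simp: A_def K_def)
    also have "\<dots> = C * exp x" by (simp add: A_def K_def C_def algebra_simps)
    finally show ?thesis using x by (simp add: e_def powr_minus field_simps)
  qed
  show thesis using that[OF C S B] .
qed

text \<open>Markov's inequality applied to the first moment: at least half of the weight sits on
  \<^term>\<open>k + 1 \<le> 2 * (1 + x)\<close>.\<close>
lemma cosh_negative_moment_lower:
  fixes zeta x :: real
  assumes z: "0 \<le> zeta" and x: "0 \<le> x"
    and S: "summable (\<lambda>k. x ^ (2*k) / fact (2*k) * (real k + 1) powr - zeta)"
  shows "2 powr - zeta / 4 * (exp x * (1 + x) powr - zeta)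
           \<le> (\<Sum>k. x ^ (2*k) / fact (2*k) * (real k + 1) powr - zeta)"
proof -
  define w where "w k = x ^ (2*k) / fact (2*k)" for k
  have w0: "0 \<le> w k" for k using x by (simp add: w_def)
  define H where "H = (\<Sum>k. w k * (real k + 1) powr - zeta)"
  \<comment> \<open>The affine function \<open>1 - (k + 1) / (2 * (1 + x))\<close> stands in for the
    indicator of \<open>k + 1 \<le> 2 * (1 + x)\<close>: it is at most 1 there, negative elsewhere,
    and its weighted sum is explicit.\<close>
  have "(\<lambda>k. w k * (1 - (real k + 1) / (2 * (1 + x)))) sums
      (cosh x - (x / 2 * sinh x + cosh x) * (1 / (2 * (1 + x))))"
    using sums_diff[OF cosh_even_sums[of x] sums_mult2[OF cosh_weighted_sums[of x], of "1 / (2 * (1 + x))"]]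
    unfolding w_def by (rule back_subst[of "\<lambda>f. f sums _"]) (simp add: fun_eq_iff right_diff_distrib)
  then have "(\<lambda>k. (2 * (1 + x)) powr - zeta * (w k * (1 - (real k + 1) / (2 * (1 + x))))) sums
      ((2 * (1 + x)) powr - zeta * (cosh x - (x / 2 * sinh x + cosh x) * (1 / (2 * (1 + x)))))"
    by (rule sums_mult)
  moreover have "(2 * (1 + x)) powr - zeta * (w k * (1 - (real k + 1) / (2 * (1 + x)))) \<le> w k * (real k + 1) powr - zeta" for k
  proof (cases "real k + 1 \<le> 2 * (1 + x)")
    case True
    have "(2 * (1 + x)) powr - zeta \<le> (real k + 1) powr - zeta"
      using True z by (intro powr_mono2') auto
    moreover have "w k * (1 - (real k + 1) / (2 * (1 + x))) \<le> w k"
      using w0[of k] x by (simp add: mult_left_le)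
    moreover have "0 \<le> w k * (1 - (real k + 1) / (2 * (1 + x)))" using True x w0[of k] by simp
    ultimately show ?thesis by (subst (2) mult.commute) (intro mult_mono; simp)
  next
    case False
    then have "1 - (real k + 1) / (2 * (1 + x)) \<le> 0" using x by (simp add: field_simps)
    then have "(2 * (1 + x)) powr - zeta * (w k * (1 - (real k + 1) / (2 * (1 + x)))) \<le> 0"
      using w0[of k] by (intro mult_nonneg_nonpos mult_nonneg_nonpos) auto
    also have "0 \<le> w k * (real k + 1) powr - zeta" using w0 by simp
    finally show ?thesis .
  qed
  ultimately have "(2 * (1 + x)) powr - zeta * (cosh x - (x / 2 * sinh x + cosh x) * (1 / (2 * (1 + x)))) \<le> H"
    unfolding H_def using S by (intro sums_le[OF _ _ summable_sums]) (auto simp: w_def)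
  moreover have "cosh x / 2 \<le> cosh x - (x / 2 * sinh x + cosh x) * (1 / (2 * (1 + x)))"
  proof -
    have "x / 2 * sinh x + cosh x \<le> x / 2 * cosh x + cosh x"
      using x by (intro add_mono mult_left_mono) (auto simp: sinh_def cosh_def)
    also have "\<dots> \<le> (1 + x) * cosh x" using x by (simp add: algebra_simps)
    finally have "(x / 2 * sinh x + cosh x) * (1 / (2 * (1 + x))) \<le> ((1 + x) * cosh x) * (1 / (2 * (1 + x)))"
      using x by (intro mult_right_mono) auto
    also have "\<dots> = cosh x / 2" using x by (simp add: field_simps)
    finally show ?thesis by simp
  qed
  then have "(2 * (1 + x)) powr - zeta * (cosh x / 2) \<le> (2 * (1 + x)) powr - zeta * (cosh x - (x / 2 * sinh x + cosh x) * (1 / (2 * (1 + x))))"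
    by (intro mult_left_mono) auto
  moreover have "(2 * (1 + x)) powr - zeta * (exp x / 4) \<le> (2 * (1 + x)) powr - zeta * (cosh x / 2)"
    by (intro mult_left_mono) (auto simp: cosh_def)
  ultimately have "(2 * (1 + x)) powr - zeta * (exp x / 4) \<le> H" by linarith
  also have "(2 * (1 + x)) powr - zeta * (exp x / 4) = 2 powr - zeta / 4 * (exp x * (1 + x) powr - zeta)"
    using x powr_mult[of 2 "1 + x" "- zeta"] by simp
  finally show ?thesis unfolding H_def w_def .
qed

text \<open>An instance of Legendre's duplication formula. It makes the Bessel series of order -1/2
  a multiple of the \<open>cosh\<close> series.\<close>

lemma fact_times_Gamma_half: "fact k * Gamma (real k + 1/2) = sqrt pi * fact (2*k) / 4 ^ k"
proof (induction k)
  case 0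
  then show ?case by (simp add: Gamma_one_half_real)
next
  case (Suc k)
  have "Gamma (real k + 1/2 + 1) = (real k + 1/2) * Gamma (real k + 1/2)"
    by (rule Gamma_plus1) (auto elim!: nonpos_Ints_cases)
  then have "fact (Suc k) * Gamma (real (Suc k) + 1/2)
      = (real k + 1) * (real k + 1/2) * (fact k * Gamma (real k + 1/2))"
    by (simp add: add_ac)
  also have "\<dots> = sqrt pi * fact (2 * Suc k) / 4 ^ Suc k"
    unfolding Suc.IH by (simp add: field_simps)
  finally show ?case .
qed

text \<open>Termwise comparison: trading \<open>Gamma (k + zeta + 1/2)\<close> for
  \<open>(k + 1) powr zeta * Gamma (k + 1/2)\<close> leaves the \<open>cosh\<close> weights times
  \<open>(k + 1) powr - zeta\<close>, whose sum is already estimated. The model has the power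
  behaviour at 0 and the growth \<open>exp x / sqrt x\<close> at infinity.\<close>

lemma besselI_bounds:
  fixes zeta :: real
  assumes z: "0 \<le> zeta"
  obtains c C where "0 < c" "0 < C"
    "\<And>x. 0 < x \<Longrightarrow> c * (x powr (zeta - 1/2) * exp x * (1 + x) powr - zeta) \<le> besselI (zeta - 1/2) x"
    "\<And>x. 0 < x \<Longrightarrow> besselI (zeta - 1/2) x \<le> C * (x powr (zeta - 1/2) * exp x * (1 + x) powr - zeta)"
proof -
  obtain a b where ab: "0 < a" "0 < b"
    "\<And>k. a * ((real k + 1) powr zeta * Gamma (real k + 1/2)) \<le> Gamma (real k + zeta + 1/2)"
    "\<And>k. Gamma (real k + zeta + 1/2) \<le> b * ((real k + 1) powr zeta * Gamma (real k + 1/2))" by (rule Gamma_ratio_bounds[OF z], rule that)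
  obtain K where K: "0 < K"
    "\<And>x. 0 \<le> x \<Longrightarrow> summable (\<lambda>k. x ^ (2*k) / fact (2*k) * (real k + 1) powr - zeta)"
    "\<And>x. 0 \<le> x \<Longrightarrow> (\<Sum>k. x ^ (2*k) / fact (2*k) * (real k + 1) powr - zeta) \<le> K * (exp x * (1 + x) powr - zeta)"
    by (rule cosh_negative_moment_upper[OF z], rule that)
  \<comment> \<open>The numerator comes from the prefactor \<open>(x / 2) powr (zeta - 1/2)\<close>,
    the \<open>sqrt pi\<close> from the duplication formula.\<close>
  define d where "d = (1/2) powr (zeta - 1/2) / sqrt pi"
  have d: "0 < d" by (simp add: d_def)
  have T: "(x / 2) powr (2 * real k + (zeta - 1/2)) / (fact k * Gamma (real k + (zeta - 1/2) + 1))
            \<le> d / a * x powr (zeta - 1/2) * (x ^ (2*k) / fact (2*k) * (real k + 1) powr - zeta)" (is ?A)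
    "d / b * x powr (zeta - 1/2) * (x ^ (2*k) / fact (2*k) * (real k + 1) powr - zeta)
      \<le> (x / 2) powr (2 * real k + (zeta - 1/2)) / (fact k * Gamma (real k + (zeta - 1/2) + 1))" (is ?B)
    if x: "0 < x" for x k
  proof -
    have "(x / 2) powr (2 * real k + (zeta - 1/2)) = (x / 2) powr real (2 * k) * (x / 2) powr (zeta - 1/2)"
      by (simp add: powr_add)
    also have "(x / 2) powr real (2 * k) = x ^ (2*k) / 4 ^ k"
      using x by (subst powr_realpow) (auto simp: power_divide power_mult)
    also have "(x / 2) powr (zeta - 1/2) = x powr (zeta - 1/2) * (d * sqrt pi)"
      using x powr_mult[of x "1/2" "zeta - 1/2"] by (simp add: d_def)
    finally have num: "(x / 2) powr (2 * real k + (zeta - 1/2))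
        = d * x powr (zeta - 1/2) * x ^ (2*k) * (sqrt pi / 4 ^ k)" by simp
    have arg: "real k + (zeta - 1/2) + 1 = real k + zeta + 1/2" by simp
    have pz: "0 < (real k + 1) powr zeta" by simp
    have gz: "0 < Gamma (real k + zeta + 1/2)" using z by (intro Gamma_real_pos) auto
    have fa: "a * ((real k + 1) powr zeta * (sqrt pi * fact (2*k) / 4 ^ k)) \<le> fact k * Gamma (real k + zeta + 1/2)"
      using mult_left_mono[OF ab(3)[of k], of "fact k"] unfolding fact_times_Gamma_half[symmetric] by (simp add: mult_ac)
    have fb: "fact k * Gamma (real k + zeta + 1/2) \<le> b * ((real k + 1) powr zeta * (sqrt pi * fact (2*k) / 4 ^ k))"
      using mult_left_mono[OF ab(4)[of k], of "fact k"] unfolding fact_times_Gamma_half[symmetric] by (simp add: mult_ac)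
    have N: "0 \<le> d * x powr (zeta - 1/2) * x ^ (2*k) * (sqrt pi / 4 ^ k)" using x d by simp
    have e: "d / q * x powr (zeta - 1/2) * (x ^ (2*k) / fact (2*k) * (real k + 1) powr - zeta)
        = d * x powr (zeta - 1/2) * x ^ (2*k) * (sqrt pi / 4 ^ k) / (q * ((real k + 1) powr zeta * (sqrt pi * fact (2*k) / 4 ^ k)))"
      if "0 < q" for q
      using that pz by (simp add: powr_minus field_simps)
    show ?A unfolding num arg e[OF ab(1)]
      using fa N ab pz gz by (intro divide_left_mono mult_pos_pos) auto
    show ?B unfolding num arg e[OF ab(2)]
      using fb N ab pz gz by (intro divide_left_mono mult_pos_pos) auto
  qed
  have P: "0 \<le> (x / 2) powr (2 * real k + (zeta - 1/2)) / (fact k * Gamma (real k + (zeta - 1/2) + 1))" for x k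
    using z Gamma_real_pos[of "real k + (zeta - 1/2) + 1"] by auto
  have S: "summable (\<lambda>k. (x / 2) powr (2 * real k + (zeta - 1/2)) / (fact k * Gamma (real k + (zeta - 1/2) + 1)))"
    if x: "0 < x" for x
  proof (rule summable_comparison_test')
    show "summable (\<lambda>k. d / a * x powr (zeta - 1/2) * (x ^ (2*k) / fact (2*k) * (real k + 1) powr - zeta))"
      using x by (intro summable_mult K) auto
    show "norm ((x / 2) powr (2 * real k + (zeta - 1/2)) / (fact k * Gamma (real k + (zeta - 1/2) + 1)))
        \<le> d / a * x powr (zeta - 1/2) * (x ^ (2*k) / fact (2*k) * (real k + 1) powr - zeta)" for k
      using T(1)[OF x, of k] unfolding real_norm_def abs_of_nonneg[OF P] .
  qed
  show thesis
  proof (rule that[of "d / b * (2 powr - zeta / 4)" "d / a * K"])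
    fix x :: real assume x: "0 < x"
    let ?H = "\<Sum>k. x ^ (2*k) / fact (2*k) * (real k + 1) powr - zeta"
    have sH: "summable (\<lambda>k. x ^ (2*k) / fact (2*k) * (real k + 1) powr - zeta)" using K(2) x by auto
    have "besselI (zeta - 1/2) x \<le> (\<Sum>k. d / a * x powr (zeta - 1/2) * (x ^ (2*k) / fact (2*k) * (real k + 1) powr - zeta))"
      unfolding besselI_def using x sH by (intro suminf_le T S summable_mult) auto
    also have "\<dots> = d / a * x powr (zeta - 1/2) * ?H" using sH by (rule suminf_mult)
    also have "\<dots> \<le> d / a * x powr (zeta - 1/2) * (K * (exp x * (1 + x) powr - zeta))"
      using K(3)[of x] x d ab by (intro mult_left_mono) auto
    finally show "besselI (zeta - 1/2) x \<le> d / a * K * (x powr (zeta - 1/2) * exp x * (1 + x) powr - zeta)"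
      by (simp add: mult_ac)
    have "d / b * x powr (zeta - 1/2) * (2 powr - zeta / 4 * (exp x * (1 + x) powr - zeta)) \<le> d / b * x powr (zeta - 1/2) * ?H"
      using cosh_negative_moment_lower[OF z _ sH] x d ab by (intro mult_left_mono) auto
    also have "\<dots> = (\<Sum>k. d / b * x powr (zeta - 1/2) * (x ^ (2*k) / fact (2*k) * (real k + 1) powr - zeta))"
      using sH by (rule suminf_mult[symmetric])
    also have "\<dots> \<le> besselI (zeta - 1/2) x"
      unfolding besselI_def using x sH by (intro suminf_le T S summable_mult) auto
    finally show "d / b * (2 powr - zeta / 4) * (x powr (zeta - 1/2) * exp x * (1 + x) powr - zeta) \<le> besselI (zeta - 1/2) x"
      by (simp add: mult_ac)
  qed (use d ab K in auto)
qed

subsection \<open>The kernel of order two\<close>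

text \<open>With \<open>2 * u\<close> instead of \<open>u\<close> this is exactly what
  \<open>p2\<close> becomes when the Bessel function is replaced by its model, because
  \<open>1 + r * s / (2 * u) = (2 * u + r * s) / (2 * u)\<close>.\<close>

definition heat_profile :: "real \<Rightarrow> real \<Rightarrow> real \<Rightarrow> real \<Rightarrow> real" where
  "heat_profile zeta u r s = (2 * u) powr (- 1/2) * exp (- ((r - s)^2) / (4 * u)) * (2 * u + r * s) powr - zeta"

lemma heat_profile_nonneg: "0 \<le> heat_profile zeta u r s"
  by (simp add: heat_profile_def)

text \<open>At \<open>x = r * s / (2 * u)\<close> the free powers of \<open>r * s\<close> cancel and
  \<open>exp x\<close> completes the square in the Gaussian; \<open>id\<close> is this
  computation.\<close>

lemma p2_bounds:
  fixes zeta :: real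
  assumes z: "0 \<le> zeta"
  obtains c C where "0 < c" "0 < C"
    "\<And>u r s. 0 < u \<Longrightarrow> 0 < r \<Longrightarrow> 0 < s \<Longrightarrow> c * heat_profile zeta u r s \<le> p2 zeta u r s"
    "\<And>u r s. 0 < u \<Longrightarrow> 0 < r \<Longrightarrow> 0 < s \<Longrightarrow> p2 zeta u r s \<le> C * heat_profile zeta u r s"
proof -
  obtain c C where cC: "0 < c" "0 < C"
    "\<And>x. 0 < x \<Longrightarrow> c * (x powr (zeta - 1/2) * exp x * (1 + x) powr - zeta) \<le> besselI (zeta - 1/2) x"
    "\<And>x. 0 < x \<Longrightarrow> besselI (zeta - 1/2) x \<le> C * (x powr (zeta - 1/2) * exp x * (1 + x) powr - zeta)"
    by (rule besselI_bounds[OF z], rule that)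
  have id: "(r * s) powr (1/2 - zeta) / (2 * u) * exp (- (r^2 + s^2) / (4 * u))
        * ((r * s / (2 * u)) powr (zeta - 1/2) * exp (r * s / (2 * u)) * (1 + r * s / (2 * u)) powr - zeta)
        = heat_profile zeta u r s" if "0 < u" "0 < r" "0 < s" for u r s
  proof -
    define a where "a = r * s"
    define b where "b = 2 * u"
    have ab: "0 < a" "0 < b" using that by (auto simp: a_def b_def)
    have 1: "(a / b) powr (zeta - 1/2) = a powr (zeta - 1/2) * b powr (1/2 - zeta)"
    proof -
      have "(a / b) powr e = a powr e * b powr (- e)" for e
        by (subst powr_divide) (simp add: powr_minus_divide)
      from this[of "zeta - 1/2"] show ?thesis by (simp only: minus_diff_eq)
    qed
    have 2: "(1 + a / b) powr - zeta = (b + a) powr - zeta * b powr zeta"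
    proof -
      have "1 + a / b = (b + a) / b" using ab by (simp add: field_simps)
      then have "(1 + a / b) powr - zeta = (b + a) powr - zeta / b powr - zeta"
        using ab by (simp only: powr_divide)
      then show ?thesis by (simp add: powr_minus divide_inverse)
    qed
    have 3: "exp (- (r^2 + s^2) / (4 * u)) * exp (a / b) = exp (- ((r - s)^2) / (4 * u))"
      unfolding exp_add[symmetric] a_def b_def using that
      by (simp add: field_simps power2_eq_square)
    have 4: "a powr (1/2 - zeta) * a powr (zeta - 1/2) = 1"
      using ab by (simp flip: powr_add)
    have 5: "b powr (1/2 - zeta) * b powr zeta / b = b powr (- 1/2)"
    proof -
      have "b powr (1/2 - zeta) * b powr zeta / b powr 1 = b powr (1/2 - zeta + zeta - 1)"
        by (simp only: powr_add powr_diff)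
      moreover have "1/2 - zeta + zeta - 1 = - 1/2" by simp
      ultimately show ?thesis using ab by (simp only: powr_one less_imp_le)
    qed
    have "a powr (1/2 - zeta) / b * exp (- (r^2 + s^2) / (4 * u))
        * ((a / b) powr (zeta - 1/2) * exp (a / b) * (1 + a / b) powr - zeta)
      = (a powr (1/2 - zeta) * a powr (zeta - 1/2)) * (b powr (1/2 - zeta) * b powr zeta / b)
        * (exp (- (r^2 + s^2) / (4 * u)) * exp (a / b)) * (b + a) powr - zeta"
      unfolding 1 2 by (simp add: mult_ac)
    also have "\<dots> = b powr (- 1/2) * exp (- ((r - s)^2) / (4 * u)) * (b + a) powr - zeta"
      unfolding 3 4 5 by simp
    finally show ?thesis unfolding a_def b_def heat_profile_def .
  qed
  have nn: "0 \<le> (r * s) powr (1/2 - zeta) / (2 * u) * exp (- (r^2 + s^2) / (4 * u))" if "0 < u" for u r s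
    using that by simp
  show thesis
  proof (rule that[OF cC(1,2)])
    fix u r s :: real assume *: "0 < u" "0 < r" "0 < s"
    then have x: "0 < r * s / (2 * u)" by simp
    show "c * heat_profile zeta u r s \<le> p2 zeta u r s"
      using mult_left_mono[OF cC(3)[OF x] nn[OF *(1), of r s]]
      unfolding p2_def id[OF *, symmetric] by (simp only: mult.left_commute[of c])
    show "p2 zeta u r s \<le> C * heat_profile zeta u r s"
      using mult_left_mono[OF cC(4)[OF x] nn[OF *(1), of r s]]
      unfolding p2_def id[OF *, symmetric] by (simp only: mult.left_commute[of C])
  qed
qed

lemma p2_measurable [measurable]: "(\<lambda>u. p2 zeta u r s) \<in> borel_measurable borel"
  unfolding p2_def besselI_def by measurable

text \<open>From \<open>1 + 8 * w \<le> 8 * m * exp (w / m)\<close>, raised to the power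
  \<open>zeta\<close>; the choice \<open>m = 1 + zeta\<close> gives \<open>zeta / m \<le> 1\<close>
  and avoids dividing by 0 at \<open>zeta = 0\<close>. The 8 matches the later
  \<open>w = (r - s)^2 / (8 * u)\<close>.\<close>

lemma exp_minus_le_powr:
  fixes zeta w :: real
  assumes z: "0 \<le> zeta" and w: "0 \<le> w"
  shows "exp (- w) \<le> (8 * (1 + zeta)) powr zeta * (1 + 8 * w) powr - zeta"
proof -
  define m where "m = 1 + zeta"
  have m: "1 \<le> m" "zeta \<le> m" using z by (auto simp: m_def)
  have "1 + 8 * w \<le> 8 * m * (1 + w / m)" using m w by (simp add: field_simps)
  also have "\<dots> \<le> 8 * m * exp (w / m)" using m by (intro mult_left_mono exp_ge_add_one_self) auto
  finally have "(1 + 8 * w) powr zeta \<le> (8 * m * exp (w / m)) powr zeta"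
    using w z by (intro powr_mono2) auto
  also have "\<dots> = (8 * m) powr zeta * exp (w / m) powr zeta" using m by (intro powr_mult) 
  also have "exp (w / m) powr zeta = exp (w * (zeta / m))" by (simp add: powr_def)
  also have "(8 * m) powr zeta * exp (w * (zeta / m)) \<le> (8 * m) powr zeta * exp (w * 1)"
    using m w z mult_left_mono[of "zeta / m" 1 w] by (intro mult_left_mono) auto
  finally have *: "(1 + 8 * w) powr zeta \<le> (8 * m) powr zeta * exp w" by simp
  have p: "0 < (1 + 8 * w) powr zeta" using w by simp
  have "exp (- w) * (1 + 8 * w) powr zeta \<le> exp (- w) * ((8 * m) powr zeta * exp w)"
    by (rule mult_left_mono[OF *]) simp
  also have "\<dots> = (8 * m) powr zeta" by (simp add: exp_minus field_simps)
  finally show ?thesis using p unfolding m_def by (simp add: powr_minus field_simps)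
qed

text \<open>Half of the Gaussian exponent is spent on trading \<^term>\<open>r * s\<close> for \<^term>\<open>(r + s)^2\<close>.\<close>
lemma heat_profile_upper:
  fixes zeta u r s :: real
  assumes z: "0 \<le> zeta" and u: "0 < u" "0 < r" "0 < s"
  shows "heat_profile zeta u r s \<le> (32 * (1 + zeta)) powr zeta *
     ((2 * u) powr (- 1/2) * exp (- ((r - s)^2) / (8 * u)) * (u + (r + s)^2) powr - zeta)"
proof -
  define E where "E = exp (- ((r - s)^2 / (8 * u)))"
  have sp: "exp (- ((r - s)^2) / (4 * u)) = E * E"
    unfolding E_def exp_add[symmetric] using u by (simp add: field_simps)
  have w: "0 \<le> (r - s)^2 / (8 * u)" using u by simp
  have "E * (2 * u + r * s) powr - zeta
      \<le> (8 * (1 + zeta)) powr zeta * (1 + 8 * ((r - s)^2 / (8 * u))) powr - zeta * (2 * u + r * s) powr - zeta"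
    unfolding E_def by (intro mult_right_mono exp_minus_le_powr z w) simp
  also have "\<dots> = (8 * (1 + zeta)) powr zeta * ((1 + (r - s)^2 / u) * (2 * u + r * s)) powr - zeta"
    using u by (subst powr_mult) (auto simp: mult_ac)
  also have "\<dots> \<le> (8 * (1 + zeta)) powr zeta * ((u + (r + s)^2) / 4) powr - zeta"
  proof (intro mult_left_mono powr_mono2')
    \<comment> \<open>The divisor 4 in the claim comes from
      \<open>(r + s)^2 = (r - s)^2 + 4 * (r * s)\<close>: the terms \<open>r * s\<close> and
      \<open>2 * (r - s)^2\<close> of the product already cover a quarter of
      \<open>(r + s)^2\<close>.\<close>
    have "(1 + (r - s)^2 / u) * (2 * u + r * s) = 2 * u + r * s + 2 * (r - s)^2 + (r - s)^2 / u * (r * s)"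
      using u by (simp add: field_simps)
    moreover have "0 \<le> (r - s)^2 / u * (r * s)" using u by simp
    moreover have "(r + s)^2 = (r - s)^2 + 4 * (r * s)" by (simp add: power2_eq_square algebra_simps)
    moreover have "0 \<le> (r - s)^2" by simp
    ultimately show "(u + (r + s)^2) / 4 \<le> (1 + (r - s)^2 / u) * (2 * u + r * s)"
      using u by argo
    show "0 < (u + (r + s)^2) / 4" using u by (simp add: add_pos_nonneg)
  qed (use z in auto)
  also have "((u + (r + s)^2) / 4) powr - zeta = 4 powr zeta * (u + (r + s)^2) powr - zeta"
    using u by (subst powr_divide) (auto simp: powr_minus field_simps)
  also have "(8 * (1 + zeta)) powr zeta * (4 powr zeta * (u + (r + s)^2) powr - zeta)
      = (32 * (1 + zeta)) powr zeta * (u + (r + s)^2) powr - zeta"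
    using z powr_mult[of "8 * (1 + zeta)" 4 zeta] by simp
  finally have "(2 * u) powr (- 1/2) * E * (E * (2 * u + r * s) powr - zeta)
      \<le> (2 * u) powr (- 1/2) * E * ((32 * (1 + zeta)) powr zeta * (u + (r + s)^2) powr - zeta)"
    by (intro mult_left_mono) (auto simp: E_def)
  then show ?thesis unfolding heat_profile_def sp by (simp add: E_def mult_ac)
qed

section \<open>From subordinator densities to probability laws\<close>

definition stable_law :: "real \<Rightarrow> real \<Rightarrow> real measure \<Rightarrow> bool" where
  "stable_law alpha t M \<longleftrightarrow> prob_space M \<and> sets M = sets borel \<and> (AE u in M. 0 < u) \<and>
     (\<forall>lam\<ge>0. (\<integral>u. exp (- u * lam) \<partial>M) = exp (- t * lam powr (alpha / 2)))"

text \<open>The law is \<open>lborel\<close> weighted by the density cut off to the positive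
  half-line. Measurability of \<open>f\<close> suffices for the transfer of integrals, since both
  sides are 0 when \<open>f\<close> is not integrable.\<close>

lemma stable_density_imp_stable_law:
  assumes "stable_density alpha t d"
  obtains M where "stable_law alpha t M"
    "\<And>f. f \<in> borel_measurable borel \<Longrightarrow> (LINT u:{0<..}|lborel. f u * d u) = (\<integral>u. f u \<partial>M)"
proof -
  define g where "g u = indicator {0<..} u * d u" for u :: real
  define M where "M = density lborel (\<lambda>u. ennreal (g u))"
  have dm [measurable]: "d \<in> borel_measurable borel"
    and d0: "\<And>u. 0 < u \<Longrightarrow> 0 \<le> d u" and di: "set_integrable lborel {0<..} d"
    and d1: "(LINT u:{0<..}|lborel. d u) = 1"
    and dl: "\<And>lam. 0 \<le> lam \<Longrightarrow> exp (- t * lam powr (alpha / 2)) = (LINT u:{0<..}|lborel. exp (- u * lam) * d u)"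
    using assms unfolding stable_density_def by auto
  have gm [measurable]: "g \<in> borel_measurable borel" unfolding g_def by measurable
  have g0: "0 \<le> g u" for u using d0[of u] by (auto simp: g_def indicator_def)
  have I: "(LINT u:{0<..}|lborel. f u * d u) = (\<integral>u. f u \<partial>M)" if "f \<in> borel_measurable borel" for f
    unfolding M_def using that g0
    by (subst integral_density) (auto simp: set_lebesgue_integral_def g_def mult_ac intro!: Bochner_Integration.integral_cong)
  have "emeasure M (space M) = (\<integral>\<^sup>+u. ennreal (g u) \<partial>lborel)"
    unfolding M_def by (subst emeasure_density) auto
  also have "\<dots> = ennreal (\<integral>u. g u \<partial>lborel)"
    using di g0 by (intro nn_integral_eq_integral) (auto simp: set_integrable_def g_def)
  also have "(\<integral>u. g u \<partial>lborel) = 1" using d1 by (simp add: set_lebesgue_integral_def g_def)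
  finally have P: "prob_space M" by (auto intro: prob_spaceI)
  have "AE u in M. 0 < u"
    unfolding M_def by (subst AE_density) (auto simp: g_def indicator_def)
  moreover have "(\<integral>u. exp (- u * lam) \<partial>M) = exp (- t * lam powr (alpha / 2))" if "0 \<le> lam" for lam
    using dl[OF that] I[of "\<lambda>u. exp (- u * lam)"] by simp
  moreover have "sets M = sets borel" by (simp add: M_def)
  ultimately have "stable_law alpha t M"
    unfolding stable_law_def using P by blast
  then show thesis using that I by blast
qed

subsection \<open>Stable laws through their Laplace transform\<close>

lemma one_minus_exp_minus_ge:
  fixes v :: real
  assumes "0 \<le> v"
  shows "v / (1 + v) \<le> 1 - exp (- v)"
proof -
  have "exp (- v) \<le> 1 / (1 + v)"
    using exp_ge_add_one_self[of v] assms by (simp add: exp_minus field_simps)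
  moreover have "v / (1 + v) = 1 - 1 / (1 + v)" using assms by (simp add: field_simps)
  ultimately show ?thesis by simp
qed

text \<open>Up to a factor 2, \<open>1 - exp (- v)\<close> is a smooth version of
  \<open>min v 1\<close> whose mean is given by the Laplace transform.\<close>

lemma one_minus_exp_minus_ge_half:
  fixes v :: real
  shows "0 \<le> v \<Longrightarrow> v \<le> 1 \<Longrightarrow> v / 2 \<le> 1 - exp (- v)" and "1 \<le> v \<Longrightarrow> 1 / 2 \<le> 1 - exp (- v)"
proof -
  assume v: "0 \<le> v" "v \<le> 1"
  have "v / 2 \<le> v / (1 + v)" using v by (intro divide_left_mono) auto
  then show "v / 2 \<le> 1 - exp (- v)" using one_minus_exp_minus_ge[of v] v by linarith
next
  assume v: "1 \<le> v"
  have "1 / 2 \<le> v / (1 + v)" using v by (simp add: field_simps)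
  then show "1 / 2 \<le> 1 - exp (- v)" using one_minus_exp_minus_ge[of v] v by linarith
qed

text \<open>For \<open>v \<le> 1\<close> the exponential is at most \<open>128 * v^2\<close>, by
  \<open>exp w \<ge> w^2 / 2\<close> at \<open>w = 1 / (8 * v)\<close>, and this beats the singular
  power; for larger \<open>v\<close> both factors on the left are at most 1. The bound makes a
  Gaussian integrable against a law known only by its transform.\<close>

lemma powr_half_exp_le:
  fixes v :: real
  assumes v: "0 < v"
  shows "v powr (- 1/2) * exp (- 1 / (8 * v)) \<le> 256 * (1 - exp (- v))"
proof (cases "v \<le> 1")
  case True
  define w where "w = 1 / (8 * v)"
  have w: "0 < w" using v by (simp add: w_def)
  have "w^2 / 2 \<le> exp w" using exp_lower_Taylor_quadratic[of w] w by simp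
  then have "exp (- w) \<le> 2 / w^2" using w by (simp add: exp_minus field_simps)
  also have "2 / w^2 = 128 * v^2" using v by (simp add: w_def field_simps power2_eq_square)
  finally have e: "exp (- 1 / (8 * v)) \<le> 128 * v^2" by (simp add: w_def)
  have "v powr (- 1/2) * exp (- 1 / (8 * v)) \<le> v powr (- 1) * (128 * v^2)"
    using v True e by (intro mult_mono powr_mono') auto
  also have "\<dots> = 128 * v" using v by (simp add: powr_minus power2_eq_square)
  also have "\<dots> \<le> 256 * (1 - exp (- v))" using one_minus_exp_minus_ge_half(1)[of v] v True by simp
  finally show ?thesis .
next
  case False
  have "v powr (- 1/2) \<le> v powr 0" using False by (intro powr_mono) auto
  then have "v powr (- 1/2) * exp (- 1 / (8 * v)) \<le> 1 * 1" using v by (intro mult_mono) auto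
  also have "\<dots> \<le> 256 * (1 - exp (- v))" using one_minus_exp_minus_ge_half(2)[of v] False by simp
  finally show ?thesis .
qed

lemma stable_lawD:
  assumes "stable_law alpha t M"
  shows "prob_space M" "sets M = sets borel" "AE u in M. 0 < u"
    "\<And>lam. 0 \<le> lam \<Longrightarrow> (\<integral>u. exp (- u * lam) \<partial>M) = exp (- t * lam powr (alpha / 2))"
  using assms unfolding stable_law_def by auto

lemma stable_law_laplace_integrable:
  assumes M: "stable_law alpha t M" and l: "0 \<le> lam"
  shows "integrable M (\<lambda>u. exp (- u * lam))"
proof -
  interpret prob_space M using stable_lawD(1)[OF M] .
  have [measurable_cong]: "sets M = sets borel" using stable_lawD(2)[OF M] .
  have "AE u in M. norm (exp (- u * lam)) \<le> 1"
    using stable_lawD(3)[OF M] by eventually_elim (use l in auto)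
  then show ?thesis by (rule integrable_const_bound) measurable
qed

text \<open>Measures time in units of \<open>m^2\<close>: since
  \<open>(m^2) powr (alpha / 2) = m powr alpha\<close>, the scale and \<open>t\<close> enter only
  through \<open>t * m powr - alpha\<close>.\<close>

lemma stable_law_laplace_scaled:
  assumes M: "stable_law alpha t M" and m: "0 < m" and x: "0 \<le> x"
  shows "integrable M (\<lambda>u. 1 - exp (- (u * x / m^2)))"
    "(\<integral>u. 1 - exp (- (u * x / m^2)) \<partial>M) = 1 - exp (- (t * m powr - alpha * x powr (alpha / 2)))"
proof -
  interpret prob_space M using stable_lawD(1)[OF M] .
  have l: "0 \<le> x / m^2" using x by simp
  have i: "integrable M (\<lambda>u. exp (- (u * x / m^2)))"
    using stable_law_laplace_integrable[OF M l] by simp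
  then show "integrable M (\<lambda>u. 1 - exp (- (u * x / m^2)))" by simp
  have "(x / m^2) powr (alpha / 2) = x powr (alpha / 2) / (m powr 2) powr (alpha / 2)"
    using m by (simp add: powr_divide)
  also have "(m powr 2) powr (alpha / 2) = m powr alpha" by (simp only: powr_powr) simp
  finally have "(x / m^2) powr (alpha / 2) = m powr - alpha * x powr (alpha / 2)"
    by (simp add: powr_minus field_simps)
  then have "(\<integral>u. exp (- (u * x / m^2)) \<partial>M) = exp (- (t * m powr - alpha * x powr (alpha / 2)))"
    using stable_lawD(4)[OF M l] by (simp add: mult.assoc)
  then show "(\<integral>u. 1 - exp (- (u * x / m^2)) \<partial>M) = 1 - exp (- (t * m powr - alpha * x powr (alpha / 2)))"
    using i by (simp add: prob_space)
qed

text \<open>With \<open>v = u / m^2\<close> the integrand is at most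
  \<open>256 / m * (1 - exp (- v))\<close>, and the mean of \<open>1 - exp (- v)\<close> is at most
  \<open>t * m powr - alpha\<close>. This is the source of the decay in the distance.\<close>

lemma stable_law_gauss_moment:
  assumes M: "stable_law alpha t M" and m: "0 < m"
  shows "integrable M (\<lambda>u. (2 * u) powr (- 1/2) * exp (- (m^2) / (8 * u)))"
    "(\<integral>u. (2 * u) powr (- 1/2) * exp (- (m^2) / (8 * u)) \<partial>M) \<le> 256 * (t * m powr (- 1 - alpha))"
proof -
  have [measurable_cong]: "sets M = sets borel" using stable_lawD(2)[OF M] .
  let ?f = "\<lambda>u. (2 * u) powr (- 1/2) * exp (- (m^2) / (8 * u))"
  let ?g = "\<lambda>u. 256 / m * (1 - exp (- (u * 1 / m^2)))"
  note L = stable_law_laplace_scaled[OF M m zero_le_one]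
  have gi: "integrable M ?g" using L(1) by (intro integrable_mult_right) simp
  have "?f u \<le> ?g u" if u: "0 < u" for u
  proof -
    define v where "v = u / m^2"
    have v: "0 < v" "u = v * m^2" using u m by (auto simp: v_def)
    have "(2 * u) powr (- 1/2) \<le> u powr (- 1/2)" using u by (intro powr_mono2') auto
    also have "\<dots> = v powr (- 1/2) * (m powr 2) powr (- 1/2)"
      using v m by (simp add: powr_mult)
    also have "(m powr 2) powr (- 1/2) = m powr - 1" by (simp only: powr_powr) simp
    also have "m powr - 1 = 1 / m" using m by (simp add: powr_minus divide_inverse)
    finally have "(2 * u) powr (- 1/2) \<le> v powr (- 1/2) * (1 / m)" .
    moreover have "- (m^2) / (8 * u) = - 1 / (8 * v)" using u m by (simp add: v_def)
    ultimately have "?f u \<le> v powr (- 1/2) * (1 / m) * exp (- 1 / (8 * v))"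
      by (simp only:) (intro mult_right_mono, auto)
    also have "\<dots> = 1 / m * (v powr (- 1/2) * exp (- 1 / (8 * v)))" by (simp only: mult_ac)
    also have "\<dots> \<le> 1 / m * (256 * (1 - exp (- v)))"
      using m powr_half_exp_le[OF v(1)] by (intro mult_left_mono) auto
    finally show ?thesis by (simp add: v_def)
  qed
  then have le: "AE u in M. ?f u \<le> ?g u" using stable_lawD(3)[OF M] by (auto elim: eventually_mono)
  show fi: "integrable M ?f"
  proof (rule Bochner_Integration.integrable_bound[OF gi])
    show "AE u in M. norm (?f u) \<le> norm (?g u)" using le
    proof eventually_elim
      case (elim u)
      have "0 \<le> ?f u" by simp
      then show ?case using elim by (simp only: real_norm_def abs_of_nonneg order_trans[of 0])
    qed
  qed measurable
  have "(\<integral>u. ?f u \<partial>M) \<le> (\<integral>u. ?g u \<partial>M)" by (rule integral_mono_AE[OF fi gi le])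
  also have "\<dots> = 256 / m * (1 - exp (- (t * m powr - alpha)))"
    unfolding integral_mult_right_zero L(2) by simp
  also have "\<dots> \<le> 256 / m * (t * m powr - alpha)"
  proof (intro mult_left_mono)
    show "1 - exp (- (t * m powr - alpha)) \<le> t * m powr - alpha"
      using exp_ge_add_one_self[of "- (t * m powr - alpha)"] by linarith
  qed (use m in auto)
  also have "\<dots> = 256 * (t * m powr (- 1 - alpha))"
    using m by (simp add: powr_diff powr_minus field_simps)
  finally show "(\<integral>u. ?f u \<partial>M) \<le> 256 * (t * m powr (- 1 - alpha))" .
qed

lemma summable_powr_exp_minus_powr:
  fixes a b :: real
  assumes "0 < b"
  shows "summable (\<lambda>n. (real n + 1) powr a * exp (- (real n powr b)))"
proof (rule summable_comparison_test_bigo)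
  show "summable (\<lambda>n. norm (real n powr - 2))" by (simp add: summable_real_powr_iff)
  show "(\<lambda>n. (real n + 1) powr a * exp (- (real n powr b))) \<in> O(\<lambda>n. real n powr - 2)"
    using assms by real_asymp
qed

text \<open>With \<^term>\<open>n\<close> the integer part of \<^term>\<open>1 / y\<close>, the power \<^term>\<open>y powr - a\<close> is dominated by the single term
  \<^term>\<open>exp 1 * (n + 1) powr a * exp (- n * y)\<close>, so the negative moment is dominated by
  a series of Laplace transforms.\<close>
lemma stable_law_negative_moment:
  fixes alpha a :: real
  assumes al: "0 < alpha" and a: "0 < a"
  obtains K where "0 < K"
    "\<And>t M. stable_law alpha t M \<Longrightarrow> 0 < t \<Longrightarrow> integrable M (\<lambda>u. u powr - a)"
    "\<And>t M. stable_law alpha t M \<Longrightarrow> 0 < t \<Longrightarrow> (\<integral>u. u powr - a \<partial>M) \<le> K * (t powr (1 / alpha)) powr (- 2 * a)"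
proof -
  \<comment> \<open>The exponential is the Laplace transform at \<open>n / T^2\<close> with
    \<open>T = t powr (1 / alpha)\<close>, which no longer contains \<open>t\<close>. The factor
    \<open>exp 1\<close> compensates for \<open>exp (- n * y)\<close>, as
    \<open>n * y \<le> 1\<close>.\<close>
  define k where "k n = exp 1 * ((real n + 1) powr a * exp (- (real n powr (alpha / 2))))" for n
  define K where "K = (\<Sum>n. k n)"
  have sk: "summable k" unfolding k_def
    using summable_powr_exp_minus_powr[of "alpha / 2" a] al by (intro summable_mult) auto
  have k0: "0 < k n" for n by (simp add: k_def)
  have K: "0 < K" unfolding K_def using sk k0 by (intro suminf_pos) auto
  \<comment> \<open>Stated for the nonnegative integral, so that sum and integral may be exchanged
    before integrability is known; integrability then follows from finiteness.\<close>
  have main: "(\<integral>\<^sup>+u. ennreal (u powr - a) \<partial>M) \<le> ennreal (K * (t powr (1 / alpha)) powr (- 2 * a))"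
    if M: "stable_law alpha t M" and t: "0 < t" for t M
  proof -
    have [measurable_cong]: "sets M = sets borel" using stable_lawD(2)[OF M] .
    define m where "m = t powr (1 / alpha)"
    have m: "0 < m" using t by (simp add: m_def)
    have tm: "t * m powr - alpha = 1" using t al by (simp add: m_def powr_powr powr_minus)
    have E: "(\<integral>u. exp (- (u * real n / m^2)) \<partial>M) = exp (- (real n powr (alpha / 2)))"
      and I: "integrable M (\<lambda>u. exp (- (u * real n / m^2)))" for n
    proof -
      interpret prob_space M using stable_lawD(1)[OF M] .
      show i: "integrable M (\<lambda>u. exp (- (u * real n / m^2)))"
        using stable_law_laplace_integrable[OF M, of "real n / m^2"] by simp
      show "(\<integral>u. exp (- (u * real n / m^2)) \<partial>M) = exp (- (real n powr (alpha / 2)))"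
        using stable_law_laplace_scaled(2)[OF M m, of "real n"] i by (simp add: tm prob_space)
    qed
    define c where "c n = m powr (- 2 * a) * exp 1 * (real n + 1) powr a" for n
    have c0: "0 \<le> c n" for n by (simp add: c_def)
    have pt: "ennreal (u powr - a) \<le> (\<Sum>n. ennreal (c n * exp (- (u * real n / m^2))))" if u: "0 < u" for u
    proof -
      define y where "y = u / m^2"
      have y: "0 < y" using u m by (simp add: y_def)
      define n where "n = nat \<lfloor>1 / y\<rfloor>"
      have n: "real n \<le> 1 / y" "1 / y < real n + 1"
        unfolding n_def using y by auto
      have "y powr - a = (1 / y) powr a" by (subst powr_divide) (simp add: powr_minus_divide)
      also have "\<dots> \<le> (real n + 1) powr a" using n y a by (intro powr_mono2) auto
      also have "\<dots> \<le> (real n + 1) powr a * exp (1 - y * real n)"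
      proof -
        have "y * real n \<le> 1" using n(1) y by (simp add: field_simps)
        then show ?thesis using a by (intro mult_right_le_one_le[THEN order_trans] order_refl mult_le_cancel_left1[THEN iffD2]) auto
      qed
      finally have "y powr - a \<le> (real n + 1) powr a * exp (1 - y * real n)" .
      then have "m powr (- 2 * a) * y powr - a \<le> m powr (- 2 * a) * ((real n + 1) powr a * exp (1 - y * real n))"
        by (intro mult_left_mono) auto
      also have "\<dots> = c n * exp (- (u * real n / m^2))"
        by (simp add: c_def y_def exp_diff exp_minus field_simps)
      also have "m powr (- 2 * a) * y powr - a = u powr - a"
      proof -
        have "m powr (- 2 * a) = (m powr 2) powr - a" by (simp only: powr_powr) simp
        then have "m powr (- 2 * a) * y powr - a = (m^2 * y) powr - a"
          using m y by (simp add: powr_mult)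
        then show ?thesis using m by (simp add: y_def)
      qed
      finally have "ennreal (u powr - a) \<le> ennreal (c n * exp (- (u * real n / m^2)))" by (rule ennreal_leI)
      also have "\<dots> \<le> (\<Sum>n. ennreal (c n * exp (- (u * real n / m^2))))"
        using sum_le_suminf[of "\<lambda>n. ennreal (c n * exp (- (u * real n / m^2)))" "{n}"] by simp
      finally show ?thesis .
    qed
    have "(\<integral>\<^sup>+u. ennreal (u powr - a) \<partial>M) \<le> (\<integral>\<^sup>+u. (\<Sum>n. ennreal (c n * exp (- (u * real n / m^2)))) \<partial>M)"
      using stable_lawD(3)[OF M] by (intro nn_integral_mono_AE) (auto elim!: eventually_mono intro: pt)
    also have "\<dots> = (\<Sum>n. (\<integral>\<^sup>+u. ennreal (c n * exp (- (u * real n / m^2))) \<partial>M))"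
      by (rule nn_integral_suminf) measurable
    also have "\<dots> = (\<Sum>n. ennreal (m powr (- 2 * a) * k n))"
    proof (intro suminf_cong)
      fix n
      have "(\<integral>\<^sup>+u. ennreal (c n * exp (- (u * real n / m^2))) \<partial>M) = ennreal (\<integral>u. c n * exp (- (u * real n / m^2)) \<partial>M)"
        using I c0 by (intro nn_integral_eq_integral) auto
      also have "(\<integral>u. c n * exp (- (u * real n / m^2)) \<partial>M) = m powr (- 2 * a) * k n"
        using E[of n] by (simp add: c_def k_def)
      finally show "(\<integral>\<^sup>+u. ennreal (c n * exp (- (u * real n / m^2))) \<partial>M) = ennreal (m powr (- 2 * a) * k n)" .
    qed
    also have "\<dots> = ennreal (\<Sum>n. m powr (- 2 * a) * k n)"
      using sk k0 by (intro suminf_ennreal2 mult_nonneg_nonneg summable_mult) (auto intro: less_imp_le)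
    also have "(\<Sum>n. m powr (- 2 * a) * k n) = K * m powr (- 2 * a)"
      unfolding K_def suminf_mult[OF sk] by (rule mult.commute)
    finally show ?thesis by (simp add: m_def)
  qed
  have I: "integrable M (\<lambda>u. u powr - a)" if M: "stable_law alpha t M" and t: "0 < t" for t M
  proof -
    have [measurable_cong]: "sets M = sets borel" using stable_lawD(2)[OF M] .
    show ?thesis
      using main[OF M t] by (intro integrableI_nonneg) (auto intro: le_less_trans)
  qed
  have bound: "(\<integral>u. u powr - a \<partial>M) \<le> K * (t powr (1 / alpha)) powr (- 2 * a)"
    if M: "stable_law alpha t M" and t: "0 < t" for t M
  proof -
    have "ennreal (\<integral>u. u powr - a \<partial>M) \<le> ennreal (K * (t powr (1 / alpha)) powr (- 2 * a))"
      using main[OF M t] nn_integral_eq_integral[OF I[OF M t]] by simp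
    then show ?thesis using K by (subst (asm) ennreal_le_iff) auto
  qed
  show thesis by (rule that[OF K], erule (1) I, erule (1) bound)
qed

text \<open>The function \<^term>\<open>1 - exp (- v)\<close> has mean comparable to \<^term>\<open>t * m powr - alpha\<close>; the parts of that mean
  carried by very small and very large \<^term>\<open>v\<close> are small multiples of the same quantity, because
  \<^term>\<open>alpha / 2\<close> lies strictly between 0 and 1.\<close>
lemma stable_law_interval_mass:
  fixes alpha :: real
  assumes al: "0 < alpha" "alpha < 2"
  obtains A B where "0 < A" "A < B"
    "\<And>t M m. stable_law alpha t M \<Longrightarrow> 0 < t \<Longrightarrow> 0 < m \<Longrightarrow> t \<le> m powr alpha \<Longrightarrow>
       t * m powr - alpha / 4 \<le> measure M {A * m^2 .. B * m^2}"
proof -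
  define b where "b = alpha / 2"
  have b: "0 < b" "b < 1" using al by (auto simp: b_def)
  \<comment> \<open>\<open>A\<close> and \<open>B\<close> solve \<open>A powr (1 - b) = 1/16\<close>
    and \<open>B powr - b = 1/16\<close>. Each tail then costs at most \<open>2 * e / 16\<close>,
    together \<open>e / 4\<close>, out of a total mean of at least \<open>e / 2\<close>.\<close>
  define A where "A = 16 powr (- 1 / (1 - b))"
  define B where "B = 16 powr (1 / b)"
  have AB: "0 < A" "0 < B" by (auto simp: A_def B_def)
  have "A < 16 powr 0" unfolding A_def using b by (intro powr_less_mono) (auto simp: divide_neg_pos)
  moreover have "16 powr 0 < B" unfolding B_def using b by (intro powr_less_mono) auto
  ultimately have ltAB: "A < B" by simp
  have a1: "A * (1 / A) powr b = 1 / 16"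
  proof -
    have "A * (1 / A) powr b = A powr (1 - b)" using AB by (simp add: powr_diff powr_divide)
    also have "\<dots> = 16 powr (- 1 / (1 - b) * (1 - b))" by (simp add: A_def powr_powr)
    also have "- 1 / (1 - b) * (1 - b) = - 1" using b by simp
    finally show ?thesis by simp
  qed
  have b1: "(1 / B) powr b = 1 / 16"
  proof -
    have "(1 / B) powr b = 1 / B powr b" using AB by (simp add: powr_divide)
    also have "B powr b = 16" using b by (simp add: B_def powr_powr)
    finally show ?thesis .
  qed
  have "t * m powr - alpha / 4 \<le> measure M {A * m^2 .. B * m^2}"
    if M: "stable_law alpha t M" and t: "0 < t" and m: "0 < m" and tm: "t \<le> m powr alpha" for t M m
  proof -
    interpret prob_space M using stable_lawD(1)[OF M] .
    have sM [measurable_cong]: "sets M = sets borel" using stable_lawD(2)[OF M] .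
    define e where "e = t * m powr - alpha"
    have e: "0 \<le> e" "e \<le> 1" using t tm m by (auto simp: e_def powr_minus field_simps)
    define L where "L x u = 1 - exp (- (u * x / m^2))" for x u
    have Li: "integrable M (L x)" and LE: "(\<integral>u. L x u \<partial>M) = 1 - exp (- (e * x powr b))" if "0 \<le> x" for x
      using stable_law_laplace_scaled[OF M m that] by (simp_all add: L_def[abs_def] e_def b_def)
    define I where "I = {A * m^2 .. B * m^2}"
    have I [measurable]: "I \<in> sets M" by (simp add: I_def sM)
    \<comment> \<open>Below the interval \<open>L 1 u \<le> v \<le> 2 * A * L (1 / A) u\<close>,
      above it \<open>L 1 u \<le> 1 \<le> 2 * L (1 / B) u\<close>: the tails are tested at
      frequencies adapted to the endpoints.\<close>
    have pt: "L 1 u \<le> indicator I u + 2 * A * L (1 / A) u + 2 * L (1 / B) u" if u: "0 < u" for u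
    proof -
      define v where "v = u / m^2"
      have v: "0 < v" "u = v * m^2" using u m by (auto simp: v_def)
      have Lv: "L x u = 1 - exp (- (v * x))" for x by (simp add: L_def v_def)
      have nn: "0 \<le> L x u" if "0 \<le> x" for x using that v(1) by (simp add: Lv)
      have inI: "u \<in> I \<longleftrightarrow> A \<le> v \<and> v \<le> B" using m by (simp add: I_def v(2))
      have nA: "0 \<le> 2 * A * L (1 / A) u" using nn AB by simp
      have nB: "0 \<le> 2 * L (1 / B) u" using nn AB by simp
      consider "v < A" | "A \<le> v" "v \<le> B" | "B < v" by linarith
      then show ?thesis
      proof cases
        case 1
        have "v / A / 2 \<le> L (1 / A) u"
          using one_minus_exp_minus_ge_half(1)[of "v / A"] 1 v(1) AB by (simp add: Lv)
        then have "v \<le> 2 * A * L (1 / A) u" using AB by (simp add: field_simps)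
        moreover have "L 1 u \<le> v" using exp_ge_add_one_self[of "- v"] by (simp add: Lv)
        moreover have "0 \<le> (indicator I u :: real)" by simp
        ultimately show ?thesis using nB by linarith
      next
        case 2
        then have "indicator I u = (1::real)" using inI by simp
        moreover have "L 1 u \<le> 1" by (simp add: Lv)
        ultimately show ?thesis using nA nB by linarith
      next
        case 3
        have "1 / 2 \<le> L (1 / B) u"
          using one_minus_exp_minus_ge_half(2)[of "v / B"] 3 v(1) AB by (simp add: Lv)
        moreover have "L 1 u \<le> 1" by (simp add: Lv)
        moreover have "0 \<le> (indicator I u :: real)" by simp
        ultimately show ?thesis using nA by linarith
      qed
    qed
    have Ii: "integrable M (indicator I :: real \<Rightarrow> real)" by (simp add: less_top[symmetric])
    have "(\<integral>u. L 1 u \<partial>M) \<le> (\<integral>u. indicator I u + 2 * A * L (1 / A) u + 2 * L (1 / B) u \<partial>M)"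
      using AB Ii Li stable_lawD(3)[OF M]
      by (intro integral_mono_AE Bochner_Integration.integrable_add integrable_mult_right) (auto elim!: eventually_mono intro: pt)
    also have "\<dots> = measure M I + 2 * A * (1 - exp (- (e * (1 / A) powr b))) + 2 * (1 - exp (- (e * (1 / B) powr b)))"
      using AB Ii Li LE by simp
    also have "\<dots> \<le> measure M I + 2 * A * (e * (1 / A) powr b) + 2 * (e * (1 / B) powr b)"
    proof -
      have *: "1 - exp (- w) \<le> w" for w :: real using exp_ge_add_one_self[of "- w"] by simp
      show ?thesis using AB by (intro add_mono mult_left_mono * order_refl) auto
    qed
    also have "\<dots> = measure M I + 2 * e * (A * (1 / A) powr b) + 2 * (e * (1 / B) powr b)" by simp
    also have "\<dots> = measure M I + e / 4" unfolding a1 b1 by simp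
    finally have "1 - exp (- e) \<le> measure M I + e / 4" using LE[of 1] by simp
    then show ?thesis using one_minus_exp_minus_ge_half(1)[of e] e by (simp add: I_def e_def)
  qed
  then show thesis using that[OF AB(1) ltAB] by blast
qed

subsection \<open>The kernel of order alpha\<close>

definition kernel_profile :: "real \<Rightarrow> real \<Rightarrow> real \<Rightarrow> real \<Rightarrow> real \<Rightarrow> real" where
  "kernel_profile zeta alpha t r s =
     t * max \<bar>r - s\<bar> (t powr (1 / alpha)) powr (- 1 - alpha) * (r + s + t powr (1 / alpha)) powr (- 2 * zeta)"

lemma kernel_profile_nonneg: "0 \<le> t \<Longrightarrow> 0 \<le> kernel_profile zeta alpha t r s"
  by (simp add: kernel_profile_def)

text \<open>Three pointwise majorants serve three regimes: \<open>upR\<close> keeps the Gaussian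
  when \<open>\<bar>r - s\<bar>\<close> dominates \<open>T\<close>, \<open>upR'\<close> drops it
  when only \<open>r + s\<close> does, and \<open>upT\<close> also replaces \<open>(r + s)^2\<close>
  by \<open>u\<close> when \<open>T\<close> dominates both. Their means are the Gaussian moment and
  the negative moments of orders \<open>1/2\<close> and \<open>1/2 + zeta\<close>.\<close>

lemma stable_law_p2_upper:
  fixes zeta alpha :: real
  assumes z: "0 \<le> zeta" and al: "0 < alpha"
  obtains C where "0 < C"
    "\<And>t M r s. stable_law alpha t M \<Longrightarrow> 0 < t \<Longrightarrow> 0 < r \<Longrightarrow> 0 < s \<Longrightarrow> integrable M (\<lambda>u. p2 zeta u r s)"
    "\<And>t M r s. stable_law alpha t M \<Longrightarrow> 0 < t \<Longrightarrow> 0 < r \<Longrightarrow> 0 < s \<Longrightarrow>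
       (\<integral>u. p2 zeta u r s \<partial>M) \<le> C * kernel_profile zeta alpha t r s"
proof -
  obtain c1 C1 where c1: "0 < c1" "0 < C1"
    "\<And>u r s. 0 < u \<Longrightarrow> 0 < r \<Longrightarrow> 0 < s \<Longrightarrow> c1 * heat_profile zeta u r s \<le> p2 zeta u r s"
    "\<And>u r s. 0 < u \<Longrightarrow> 0 < r \<Longrightarrow> 0 < s \<Longrightarrow> p2 zeta u r s \<le> C1 * heat_profile zeta u r s"
    by (rule p2_bounds[OF z], rule that)
  define C2 where "C2 = C1 * (32 * (1 + zeta)) powr zeta"
  have C2: "0 < C2" using c1 z by (simp add: C2_def)
  have half: "(0::real) < 1/2" "0 < 1/2 + zeta" using z by auto
  obtain K where K: "0 < K"
    "\<And>t M. stable_law alpha t M \<Longrightarrow> 0 < t \<Longrightarrow> integrable M (\<lambda>u. u powr - (1/2))"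
    "\<And>t M. stable_law alpha t M \<Longrightarrow> 0 < t \<Longrightarrow> (\<integral>u. u powr - (1/2) \<partial>M) \<le> K * (t powr (1 / alpha)) powr (- 2 * (1/2))"
    by (rule stable_law_negative_moment[OF al half(1)], rule that)
  obtain K' where K': "0 < K'"
    "\<And>t M. stable_law alpha t M \<Longrightarrow> 0 < t \<Longrightarrow> integrable M (\<lambda>u. u powr - (1/2 + zeta))"
    "\<And>t M. stable_law alpha t M \<Longrightarrow> 0 < t \<Longrightarrow> (\<integral>u. u powr - (1/2 + zeta) \<partial>M) \<le> K' * (t powr (1 / alpha)) powr (- 2 * (1/2 + zeta))"
    by (rule stable_law_negative_moment[OF al half(2)], rule that)
  define J where "J = 256 + K + K'"
  have J: "0 < J" "256 \<le> J" "K \<le> J" "K' \<le> J" using K K' by (auto simp: J_def)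
  have nn: "0 \<le> p2 zeta u r s" if "0 < u" "0 < r" "0 < s" for u r s
    using c1(3)[OF that] c1(1) heat_profile_nonneg[of zeta u r s] by (meson less_imp_le mult_nonneg_nonneg order_trans)
  have up: "p2 zeta u r s \<le> C2 * ((2 * u) powr (- 1/2) * exp (- ((r - s)^2) / (8 * u)) * (u + (r + s)^2) powr - zeta)"
    if "0 < u" "0 < r" "0 < s" for u r s
    using c1(4)[OF that] mult_left_mono[OF heat_profile_upper[OF z that] less_imp_le[OF c1(2)]]
    unfolding C2_def mult.assoc by (rule order_trans)
  have upR: "p2 zeta u r s \<le> C2 * (r + s) powr (- 2 * zeta) * ((2 * u) powr (- 1/2) * exp (- (\<bar>r - s\<bar>^2) / (8 * u)))"
    if u: "0 < u" "0 < r" "0 < s" for u r s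
  proof -
    have "(u + (r + s)^2) powr - zeta \<le> ((r + s)^2) powr - zeta"
      using u z by (intro powr_mono2') auto
    also have "((r + s)^2) powr - zeta = ((r + s) powr 2) powr - zeta" using u by simp
    also have "\<dots> = (r + s) powr (- 2 * zeta)" by (simp only: powr_powr) simp
    finally have "C2 * ((2 * u) powr (- 1/2) * exp (- ((r - s)^2) / (8 * u)) * (u + (r + s)^2) powr - zeta)
        \<le> C2 * ((2 * u) powr (- 1/2) * exp (- ((r - s)^2) / (8 * u)) * (r + s) powr (- 2 * zeta))"
      using C2 by (intro mult_left_mono) auto
    then show ?thesis using up[OF u] by (simp add: mult_ac)
  qed
  have dbl: "(2 * u) powr (- 1/2) * exp (- w / (8 * u)) \<le> u powr - (1/2)" if "0 < u" "0 \<le> w" for u w :: real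
  proof -
    have "(2 * u) powr (- 1/2) \<le> u powr (- 1/2)" using that by (intro powr_mono2') auto
    moreover have "exp (- w / (8 * u)) \<le> 1" using that by simp
    ultimately have "(2 * u) powr (- 1/2) * exp (- w / (8 * u)) \<le> u powr (- 1/2) * 1"
      by (intro mult_mono) auto
    then show ?thesis by simp
  qed
  have upR': "p2 zeta u r s \<le> C2 * (r + s) powr (- 2 * zeta) * u powr - (1/2)"
    if u: "0 < u" "0 < r" "0 < s" for u r s
  proof -
    have "C2 * (r + s) powr (- 2 * zeta) * ((2 * u) powr (- 1/2) * exp (- (\<bar>r - s\<bar>^2) / (8 * u)))
        \<le> C2 * (r + s) powr (- 2 * zeta) * u powr - (1/2)"
      using C2 u by (intro mult_left_mono dbl) auto
    then show ?thesis using upR[OF u] by linarith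
  qed
  have upT: "p2 zeta u r s \<le> C2 * u powr - (1/2 + zeta)"
    if u: "0 < u" "0 < r" "0 < s" for u r s
  proof -
    have "(u + (r + s)^2) powr - zeta \<le> u powr - zeta"
      using u z by (intro powr_mono2') auto
    then have "C2 * ((2 * u) powr (- 1/2) * exp (- ((r - s)^2) / (8 * u)) * (u + (r + s)^2) powr - zeta)
        \<le> C2 * (u powr - (1/2) * u powr - zeta)"
      using C2 dbl[OF u(1), of "(r - s)^2"] by (intro mult_left_mono mult_mono) auto
    also have "u powr - (1/2) * u powr - zeta = u powr - (1/2 + zeta)"
      unfolding powr_add[symmetric] by simp
    finally show ?thesis using up[OF u] by simp
  qed
  have int: "integrable M (\<lambda>u. p2 zeta u r s)"
    if M: "stable_law alpha t M" and t: "0 < t" "0 < r" "0 < s" for t M r s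
  proof -
    have [measurable_cong]: "sets M = sets borel" using stable_lawD(2)[OF M] .
    have g: "integrable M (\<lambda>u. C2 * u powr - (1/2 + zeta))" using K'(2)[OF M t(1)] by (rule integrable_mult_right)
    show ?thesis
    proof (rule Bochner_Integration.integrable_bound[OF g])
      show "AE u in M. norm (p2 zeta u r s) \<le> norm (C2 * u powr - (1/2 + zeta))"
        using stable_lawD(3)[OF M]
      proof eventually_elim
        case (elim u)
        then show ?case using upT[of u r s] nn[of u r s] t C2 by simp
      qed
    qed measurable
  qed
  have est: "(\<integral>u. p2 zeta u r s \<partial>M) \<le> k * (\<integral>u. f u \<partial>M)"
    if M: "stable_law alpha t M" and t: "0 < t" "0 < r" "0 < s" and f: "integrable M f"
      "\<And>u. 0 < u \<Longrightarrow> p2 zeta u r s \<le> k * f u" for t M r s k and f :: "real \<Rightarrow> real"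
  proof -
    have "(\<integral>u. p2 zeta u r s \<partial>M) \<le> (\<integral>u. k * f u \<partial>M)"
      using stable_lawD(3)[OF M] by (intro integral_mono_AE int[OF M t] integrable_mult_right f(1)) (auto elim!: eventually_mono intro: f)
    then show ?thesis by simp
  qed
  define C where "C = C2 * J * 4 powr zeta"
  have C: "0 < C" using C2 J by (simp add: C_def)
  have bound: "(\<integral>u. p2 zeta u r s \<partial>M) \<le> C * kernel_profile zeta alpha t r s"
    if M: "stable_law alpha t M" and t: "0 < t" "0 < r" "0 < s" for t M r s
  proof -
    define T where "T = t powr (1 / alpha)"
    have T: "0 < T" using t by (simp add: T_def)
    \<comment> \<open>When \<open>T\<close> exceeds \<open>\<bar>r - s\<bar>\<close> the first part
      of the profile collapses to \<open>1 / T\<close>, which is what the moment of order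
      \<open>1/2\<close> yields.\<close>
    have tT: "t * T powr (- 1 - alpha) = T powr - 1"
    proof -
      have "T powr (- 1 - alpha) = T powr - 1 / T powr alpha" by (rule powr_diff)
      moreover have "T powr alpha = t" using t al by (simp add: T_def powr_powr)
      ultimately show ?thesis using t by simp
    qed
    define R where "R = r + s"
    have R: "0 < R" "\<bar>r - s\<bar> \<le> R" using t by (auto simp: R_def)
    \<comment> \<open>Used with \<open>X\<close> the larger of \<open>R\<close> and
      \<open>T\<close>, which is at least half of their sum; \<open>4 powr zeta\<close> is
      \<open>2 powr (2 * zeta)\<close>.\<close>
    have two: "X powr (- 2 * zeta) \<le> 4 powr zeta * (R + T) powr (- 2 * zeta)" if X: "0 < X" "R + T \<le> 2 * X" for X
    proof -
      have "(2 * X) powr (- 2 * zeta) \<le> (R + T) powr (- 2 * zeta)"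
        using R T X z by (intro powr_mono2') auto
      moreover have "(2 * X) powr (- 2 * zeta) = 2 powr (- 2 * zeta) * X powr (- 2 * zeta)"
        using X by (intro powr_mult)
      moreover have "2 powr (- 2 * zeta) = 1 / 4 powr zeta"
      proof -
        have "2 powr (- 2 * zeta) = (2 powr 2) powr - zeta" by (simp only: powr_powr) simp
        then show ?thesis by (simp add: powr_minus_divide)
      qed
      ultimately show ?thesis by (simp add: pos_divide_le_eq mult.commute)
    qed
    have k: "kernel_profile zeta alpha t r s = t * max \<bar>r - s\<bar> T powr (- 1 - alpha) * (R + T) powr (- 2 * zeta)"
      by (simp add: kernel_profile_def T_def R_def)
    consider (far) "T \<le> \<bar>r - s\<bar>" | (mid) "\<bar>r - s\<bar> < T" "T \<le> R" | (near) "\<bar>r - s\<bar> < T" "R < T" by linarith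
    then show ?thesis
    proof cases
      case far
      have D: "0 < \<bar>r - s\<bar>" using far T by linarith
      have "(\<integral>u. p2 zeta u r s \<partial>M) \<le> C2 * R powr (- 2 * zeta) * (\<integral>u. (2 * u) powr (- 1/2) * exp (- (\<bar>r - s\<bar>^2) / (8 * u)) \<partial>M)"
        unfolding R_def by (rule est[OF M t stable_law_gauss_moment(1)[OF M D] upR]) (use t in auto)
      also have "\<dots> \<le> C2 * (4 powr zeta * (R + T) powr (- 2 * zeta)) * (256 * (t * \<bar>r - s\<bar> powr (- 1 - alpha)))"
      proof (intro mult_mono two stable_law_gauss_moment(2)[OF M D])
        show "0 \<le> (\<integral>u. (2 * u) powr (- 1/2) * exp (- (\<bar>r - s\<bar>^2) / (8 * u)) \<partial>M)"
          by (intro Bochner_Integration.integral_nonneg) simp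
      qed (use far R T C2 in auto)
      also have "\<dots> \<le> C2 * (4 powr zeta * (R + T) powr (- 2 * zeta)) * (J * (t * \<bar>r - s\<bar> powr (- 1 - alpha)))"
        using J C2 t by (intro mult_left_mono mult_right_mono) auto
      also have "\<dots> = C * kernel_profile zeta alpha t r s" using far by (simp add: k C_def max_def)
      finally show ?thesis .
    next
      case mid
      have "(\<integral>u. p2 zeta u r s \<partial>M) \<le> C2 * R powr (- 2 * zeta) * (\<integral>u. u powr - (1/2) \<partial>M)"
        unfolding R_def by (rule est[OF M t K(2)[OF M t(1)] upR']) (use t in auto)
      also have "\<dots> \<le> C2 * (4 powr zeta * (R + T) powr (- 2 * zeta)) * (K * T powr (- 2 * (1/2)))"
        unfolding T_def
      proof (intro mult_mono K(3)[OF M t(1)])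
        show "R powr (- 2 * zeta) \<le> 4 powr zeta * (R + t powr (1 / alpha)) powr (- 2 * zeta)"
          using two[of R] mid R unfolding T_def by auto
      qed (use C2 in auto)
      also have "\<dots> \<le> C2 * (4 powr zeta * (R + T) powr (- 2 * zeta)) * (J * T powr (- 2 * (1/2)))"
        using J C2 t by (intro mult_left_mono mult_right_mono) auto
      also have "\<dots> = C * kernel_profile zeta alpha t r s" using mid tT by (simp add: k C_def max_def)
      finally show ?thesis .
    next
      case near
      have "(\<integral>u. p2 zeta u r s \<partial>M) \<le> C2 * (\<integral>u. u powr - (1/2 + zeta) \<partial>M)"
        by (rule est[OF M t K'(2)[OF M t(1)] upT]) (use t in auto)
      also have "\<dots> \<le> C2 * (K' * T powr (- 2 * (1/2 + zeta)))"
        unfolding T_def using C2 by (intro mult_left_mono K'(3)[OF M t(1)]) auto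
      also have "\<dots> \<le> C2 * (J * T powr (- 2 * (1/2 + zeta)))"
        using J C2 t by (intro mult_left_mono mult_right_mono) auto
      also have "T powr (- 2 * (1/2 + zeta)) = T powr - 1 * T powr (- 2 * zeta)"
        unfolding powr_add[symmetric] by (simp add: algebra_simps)
      also have "C2 * (J * (T powr - 1 * T powr (- 2 * zeta)))
          \<le> C2 * (J * (T powr - 1 * (4 powr zeta * (R + T) powr (- 2 * zeta))))"
        using two[of T] near T C2 J by (intro mult_left_mono) auto
      also have "\<dots> = C * kernel_profile zeta alpha t r s" using near tT by (simp add: k C_def max_def)
      finally show ?thesis .
    qed
  qed
  show thesis by (rule that[OF C], erule (3) int, erule (3) bound)
qed

text \<open>Only times \<open>u\<close> between \<open>A * m^2\<close> and \<open>B * m^2\<close>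
  are kept, where \<open>m\<close> is the space-time distance. There the kernel is at least a
  multiple of \<open>m powr - 1 * R powr (- 2 * zeta)\<close>, and since \<open>T \<le> m\<close>
  the mass estimate supplies the remaining \<open>t * m powr - alpha\<close>.\<close>

lemma stable_law_p2_lower:
  fixes zeta alpha :: real
  assumes z: "0 \<le> zeta" and al: "0 < alpha" "alpha < 2"
  obtains c where "0 < c"
    "\<And>t M r s. stable_law alpha t M \<Longrightarrow> 0 < t \<Longrightarrow> 0 < r \<Longrightarrow> 0 < s \<Longrightarrow> integrable M (\<lambda>u. p2 zeta u r s) \<Longrightarrow>
       c * kernel_profile zeta alpha t r s \<le> (\<integral>u. p2 zeta u r s \<partial>M)"
proof -
  obtain c1 C1 where c1: "0 < c1" "0 < C1"
    "\<And>u r s. 0 < u \<Longrightarrow> 0 < r \<Longrightarrow> 0 < s \<Longrightarrow> c1 * heat_profile zeta u r s \<le> p2 zeta u r s"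
    "\<And>u r s. 0 < u \<Longrightarrow> 0 < r \<Longrightarrow> 0 < s \<Longrightarrow> p2 zeta u r s \<le> C1 * heat_profile zeta u r s"
    by (rule p2_bounds[OF z], rule that)
  obtain A B where AB: "0 < A" "A < B" and mass:
    "\<And>t M m. stable_law alpha t M \<Longrightarrow> 0 < t \<Longrightarrow> 0 < m \<Longrightarrow> t \<le> m powr alpha \<Longrightarrow>
       t * m powr - alpha / 4 \<le> measure M {A * m^2 .. B * m^2}"
    by (rule stable_law_interval_mass[OF al], rule that)
  \<comment> \<open>The powers decrease in \<open>u\<close> and are evaluated at the upper end
    \<open>B\<close>, the Gaussian increases in \<open>u\<close> and is evaluated at the lower end
    \<open>A\<close>. The summand 1 accounts for \<open>r * s \<le> R^2\<close>.\<close>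
  define q where "q = c1 * ((2 * B) powr (- 1/2) * exp (- 1 / (4 * A)) * (2 * B + 1) powr - zeta)"
  have q: "0 < q" using c1 AB by (simp add: q_def)
  have "q / 4 * kernel_profile zeta alpha t r s \<le> (\<integral>u. p2 zeta u r s \<partial>M)"
    if M: "stable_law alpha t M" and t: "0 < t" "0 < r" "0 < s" and i: "integrable M (\<lambda>u. p2 zeta u r s)" for t M r s
  proof -
    interpret prob_space M using stable_lawD(1)[OF M] .
    have sM [measurable_cong]: "sets M = sets borel" using stable_lawD(2)[OF M] .
    define T where "T = t powr (1 / alpha)"
    have T: "0 < T" using t by (simp add: T_def)
    define m where "m = max \<bar>r - s\<bar> T"
    have m: "0 < m" "T \<le> m" "\<bar>r - s\<bar> \<le> m" using T by (auto simp: m_def)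
    have "t = T powr alpha" using t al by (simp add: T_def powr_powr)
    also have "\<dots> \<le> m powr alpha" using m T al by (intro powr_mono2) auto
    finally have tm: "t \<le> m powr alpha" .
    define R where "R = r + s + T"
    have R: "0 < R" "m \<le> R" using t T by (auto simp: R_def m_def)
    define I where "I = {A * m^2 .. B * m^2}"
    have I [measurable]: "I \<in> sets M" by (simp add: I_def sM)
    define w where "w = q * (m powr - 1 * R powr (- 2 * zeta))"
    have w: "0 \<le> w" using q by (simp add: w_def)
    have pt: "w * indicator I u \<le> p2 zeta u r s" if u: "0 < u" for u
    proof (cases "u \<in> I")
      case False
      have "0 \<le> c1 * heat_profile zeta u r s" using c1(1) heat_profile_nonneg by simp
      then show ?thesis using False c1(3)[OF u t(2,3)] by simp
    next
      case True
      then have ul: "A * m^2 \<le> u" "u \<le> B * m^2" by (auto simp: I_def)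
      have 1: "(2 * B) powr (- 1/2) * m powr - 1 \<le> (2 * u) powr (- 1/2)"
      proof -
        have "(2 * B * m^2) powr (- 1/2) \<le> (2 * u) powr (- 1/2)"
          using ul u by (intro powr_mono2') auto
        moreover have "(2 * B * m^2) powr (- 1/2) = (2 * B) powr (- 1/2) * (m powr 2) powr (- 1/2)"
          using m AB by (simp add: powr_mult)
        moreover have "(m powr 2) powr (- 1/2) = m powr - 1" by (simp only: powr_powr) simp
        ultimately show ?thesis by simp
      qed
      have 2: "exp (- 1 / (4 * A)) \<le> exp (- ((r - s)^2) / (4 * u))"
      proof -
        have "(r - s)^2 \<le> m^2" using m by (simp add: abs_le_square_iff[symmetric])
        then have "A * (r - s)^2 \<le> A * m^2" using AB by simp
        then have "A * (r - s)^2 \<le> u" using ul by linarith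
        then have "(r - s)^2 / (4 * u) \<le> 1 / (4 * A)" using u AB by (simp add: field_simps)
        then show ?thesis by simp
      qed
      have 3: "(2 * B + 1) powr - zeta * R powr (- 2 * zeta) \<le> (2 * u + r * s) powr - zeta"
      proof -
        have "B * m^2 \<le> B * R^2" using AB m R by (intro mult_left_mono power_mono) auto
        moreover have "r * s \<le> R^2"
        proof -
          have "r * s \<le> R * R" using t T by (intro mult_mono) (auto simp: R_def)
          then show ?thesis by (simp add: power2_eq_square)
        qed
        ultimately have "2 * u + r * s \<le> (2 * B + 1) * R^2" using ul by (simp add: algebra_simps)
        then have "((2 * B + 1) * R^2) powr - zeta \<le> (2 * u + r * s) powr - zeta"
          using u t z by (intro powr_mono2') (auto intro: add_pos_pos)
        moreover have "((2 * B + 1) * R^2) powr - zeta = (2 * B + 1) powr - zeta * (R powr 2) powr - zeta"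
          using R AB by (simp add: powr_mult)
        moreover have "(R powr 2) powr - zeta = R powr (- 2 * zeta)" by (simp only: powr_powr) simp
        ultimately show ?thesis by simp
      qed
      have "w = c1 * (((2 * B) powr (- 1/2) * m powr - 1) * exp (- 1 / (4 * A)) * ((2 * B + 1) powr - zeta * R powr (- 2 * zeta)))"
        by (simp add: w_def q_def mult_ac)
      also have "\<dots> \<le> c1 * heat_profile zeta u r s"
        unfolding heat_profile_def using c1(1) by (intro mult_left_mono mult_mono 1 2 3) auto
      also have "\<dots> \<le> p2 zeta u r s" using c1(3)[OF u t(2,3)] .
      finally show ?thesis using True by simp
    qed
    have Ii: "integrable M (indicator I :: real \<Rightarrow> real)" by (simp add: less_top[symmetric])
    have "q / 4 * kernel_profile zeta alpha t r s = w * (t * m powr - alpha / 4)"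
    proof -
      have "m powr (- 1 - alpha) = m powr - 1 * m powr - alpha" unfolding powr_add[symmetric] by simp
      then show ?thesis
        unfolding kernel_profile_def w_def T_def[symmetric] m_def[symmetric] R_def[symmetric]
        by (simp add: field_simps)
    qed
    also have "\<dots> \<le> w * measure M I"
      using mass[OF M t(1) m(1) tm] w unfolding I_def by (rule mult_left_mono)
    also have "\<dots> = (\<integral>u. w * indicator I u \<partial>M)" by simp
    also have "\<dots> \<le> (\<integral>u. p2 zeta u r s \<partial>M)"
      using stable_lawD(3)[OF M] by (intro integral_mono_AE integrable_mult_right Ii i) (auto elim!: eventually_mono intro: pt)
    finally show ?thesis .
  qed
  then show thesis using that[of "q / 4"] q by auto
qed

lemma p_alpha_bounds:
  fixes zeta alpha :: real
  assumes z: "0 \<le> zeta" and al: "0 < alpha" "alpha < 2"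
  obtains c C where "0 < c" "0 < C"
    "\<And>dens t r s. stable_density alpha t (dens t) \<Longrightarrow> 0 < t \<Longrightarrow> 0 < r \<Longrightarrow> 0 < s \<Longrightarrow>
       c * kernel_profile zeta alpha t r s \<le> p_alpha dens zeta t r s"
    "\<And>dens t r s. stable_density alpha t (dens t) \<Longrightarrow> 0 < t \<Longrightarrow> 0 < r \<Longrightarrow> 0 < s \<Longrightarrow>
       p_alpha dens zeta t r s \<le> C * kernel_profile zeta alpha t r s"
proof -
  obtain C where C: "0 < C"
    "\<And>t M r s. stable_law alpha t M \<Longrightarrow> 0 < t \<Longrightarrow> 0 < r \<Longrightarrow> 0 < s \<Longrightarrow> integrable M (\<lambda>u. p2 zeta u r s)"
    "\<And>t M r s. stable_law alpha t M \<Longrightarrow> 0 < t \<Longrightarrow> 0 < r \<Longrightarrow> 0 < s \<Longrightarrow>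
       (\<integral>u. p2 zeta u r s \<partial>M) \<le> C * kernel_profile zeta alpha t r s"
    by (rule stable_law_p2_upper[OF z al(1)], rule that)
  obtain c where c: "0 < c"
    "\<And>t M r s. stable_law alpha t M \<Longrightarrow> 0 < t \<Longrightarrow> 0 < r \<Longrightarrow> 0 < s \<Longrightarrow> integrable M (\<lambda>u. p2 zeta u r s) \<Longrightarrow>
       c * kernel_profile zeta alpha t r s \<le> (\<integral>u. p2 zeta u r s \<partial>M)"
    by (rule stable_law_p2_lower[OF z al], rule that)
  show thesis
  proof (rule that[OF c(1) C(1)])
    fix dens :: "real \<Rightarrow> real \<Rightarrow> real" and t r s :: real
    assume d: "stable_density alpha t (dens t)" and t: "0 < t" "0 < r" "0 < s"
    obtain M where M: "stable_law alpha t M"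
      "\<And>f. f \<in> borel_measurable borel \<Longrightarrow> (LINT u:{0<..}|lborel. f u * dens t u) = (\<integral>u. f u \<partial>M)"
      by (rule stable_density_imp_stable_law[OF d], rule that)
    have p: "p_alpha dens zeta t r s = (\<integral>u. p2 zeta u r s \<partial>M)"
      unfolding p_alpha_def by (rule M(2)[OF p2_measurable])
    show "c * kernel_profile zeta alpha t r s \<le> p_alpha dens zeta t r s"
      unfolding p by (rule c(2)[OF M(1) t C(2)[OF M(1) t]])
    show "p_alpha dens zeta t r s \<le> C * kernel_profile zeta alpha t r s"
      unfolding p by (rule C(3)[OF M(1) t])
  qed
qed

section \<open>Geometry of the profile\<close>

lemma kernel_profile_commute: "kernel_profile zeta alpha t r s = kernel_profile zeta alpha t s r"
  by (simp add: kernel_profile_def abs_minus_commute add.commute)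

text \<open>By \<open>far\<close> the leg from \<open>r\<close> to \<open>z\<close> has the larger
  space-time distance \<open>M1\<close>, so \<open>M3 \<le> K * M1\<close>, while
  \<open>t \<le> t + \<tau>\<close>. The weight is combined with the remaining spatial
  factor.\<close>

lemma kernel_profile_three_point:
  fixes zeta alpha :: real
  assumes nn: "0 \<le> zeta" and al: "0 < alpha" and pos: "0 < r" "0 < s" "0 < z" "0 < t" "0 < \<tau>"
    and far: "max \<bar>z - s\<bar> (\<tau> powr (1 / alpha)) \<le> max \<bar>r - z\<bar> (t powr (1 / alpha))"
  shows "((r + z) / (r + s + z)) powr (2 * zeta) * kernel_profile zeta alpha t r z
    \<le> (2 * 2 powr (1 / alpha)) powr (1 + alpha) * (1 + 2 * 2 powr (1 / alpha)) powr (2 * zeta)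
        * kernel_profile zeta alpha (t + \<tau>) r s"
proof -
  define T1 T2 T3 where T: "T1 = t powr (1 / alpha)" "T2 = \<tau> powr (1 / alpha)" "T3 = (t + \<tau>) powr (1 / alpha)"
  have Tp: "0 < T1" "0 < T2" "0 < T3" using pos by (auto simp: T)
  \<comment> \<open>One factor 2 allows for the two legs in \<open>\<bar>r - s\<bar>\<close>;
    \<open>2 powr (1 / alpha)\<close> comes from
    \<open>t + \<tau> \<le> 2 * max t \<tau>\<close>.\<close>
  define K where "K = 2 * 2 powr (1 / alpha)"
  have "1 \<le> 2 powr (1 / alpha)" using al by (simp add: ge_one_powr_ge_zero)
  then have K: "2 \<le> K" by (simp add: K_def)
  have T3: "T3 \<le> K / 2 * max T1 T2"
  proof -
    have "T3 \<le> (2 * max t \<tau>) powr (1 / alpha)" unfolding T using pos al by (intro powr_mono2) auto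
    also have "\<dots> = K / 2 * max t \<tau> powr (1 / alpha)" using pos by (simp add: powr_mult K_def)
    also have "max t \<tau> powr (1 / alpha) \<le> max T1 T2" by (simp add: T max_def)
    finally show ?thesis using K by simp
  qed
  define M1 where "M1 = max \<bar>r - z\<bar> T1"
  define M3 where "M3 = max \<bar>r - s\<bar> T3"
  have M1: "0 < M1" "\<bar>z - s\<bar> \<le> M1" "T2 \<le> M1" "T1 \<le> M1" "\<bar>r - z\<bar> \<le> M1"
    using Tp far unfolding M1_def T[symmetric] by auto
  have M1': "M1 \<le> r + z + T1" using pos Tp by (auto simp: M1_def)
  have M3p: "0 < M3" using Tp by (simp add: M3_def)
  have T3M: "T3 \<le> K / 2 * M1"
  proof -
    have "K / 2 * max T1 T2 \<le> K / 2 * M1" using K M1 by (intro mult_left_mono) auto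
    then show ?thesis using T3 by simp
  qed
  have M3: "M3 \<le> K * M1"
  proof -
    have "\<bar>r - s\<bar> \<le> 2 * M1" using M1 by linarith
    also have "\<dots> \<le> K * M1" using K M1 by (intro mult_right_mono) auto
    finally have "\<bar>r - s\<bar> \<le> K * M1" .
    moreover have "T3 \<le> K * M1" using T3M K M1 by (smt (verit) field_sum_of_halves mult_right_mono)
    ultimately show ?thesis by (simp add: M3_def)
  qed
  have 1: "t * M1 powr (- 1 - alpha) \<le> K powr (1 + alpha) * ((t + \<tau>) * M3 powr (- 1 - alpha))"
  proof -
    have "(K * M1) powr (- 1 - alpha) \<le> M3 powr (- 1 - alpha)"
      using M3 M3p al by (intro powr_mono2') auto
    moreover have "(K * M1) powr (- 1 - alpha) = K powr (- 1 - alpha) * M1 powr (- 1 - alpha)"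
      using K M1 by (intro powr_mult)
    moreover have "K powr (- 1 - alpha) = 1 / K powr (1 + alpha)"
      using powr_minus_divide[of K "1 + alpha"] by simp
    moreover have "0 < K powr (1 + alpha)" using K by simp
    ultimately have "M1 powr (- 1 - alpha) \<le> K powr (1 + alpha) * M3 powr (- 1 - alpha)"
      by (simp add: field_simps)
    then have "t * M1 powr (- 1 - alpha) \<le> (t + \<tau>) * (K powr (1 + alpha) * M3 powr (- 1 - alpha))"
      using pos by (intro mult_mono) auto
    then show ?thesis by (simp add: mult_ac)
  qed
  define S where "S = r + s + z"
  define X where "X = r + z + T1"
  define Y where "Y = r + s + T3"
  have SXY: "0 < S" "0 < X" "0 < Y" using pos Tp by (auto simp: S_def X_def Y_def)
  \<comment> \<open>This is \<open>(r + z) * Y \<le> (1 + K) * S * X\<close> raised to the power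
    \<open>2 * zeta\<close>: the part \<open>r + s\<close> of \<open>Y\<close> is bounded by
    \<open>S\<close>, the part \<open>T3\<close> by \<open>K * X\<close>, and the factor
    \<open>r + z\<close> by \<open>X\<close> and by \<open>S\<close> respectively.\<close>
  have 2: "((r + z) / S) powr (2 * zeta) * X powr (- 2 * zeta) \<le> (1 + K) powr (2 * zeta) * Y powr (- 2 * zeta)"
  proof -
    have "(r + z) * Y = (r + z) * (r + s) + (r + z) * T3" by (simp add: Y_def algebra_simps)
    also have "(r + z) * (r + s) \<le> X * S" using pos Tp by (intro mult_mono) (auto simp: X_def S_def)
    also have "(r + z) * T3 \<le> S * (K * X)"
    proof (intro mult_mono)
      have "K / 2 * M1 \<le> K / 2 * X" unfolding X_def using M1' K by (intro mult_left_mono) auto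
      then have "T3 \<le> K / 2 * X" using T3M by linarith
      also have "\<dots> \<le> K * X" using K SXY by (intro mult_right_mono) auto
      finally show "T3 \<le> K * X" .
    qed (use pos Tp K in \<open>auto simp: S_def\<close>)
    finally have "(r + z) * Y \<le> (1 + K) * S * X" by (simp add: algebra_simps)
    then have "(r + z) / (S * X) \<le> (1 + K) / Y" using SXY by (simp add: field_simps)
    then have "((r + z) / (S * X)) powr (2 * zeta) \<le> ((1 + K) / Y) powr (2 * zeta)"
      using nn pos SXY by (intro powr_mono2) auto
    moreover have "((1 + K) / Y) powr (2 * zeta) = (1 + K) powr (2 * zeta) * Y powr (- 2 * zeta)"
      using powr_minus_divide[of Y "2 * zeta"] by (simp add: powr_divide)
    moreover have "((r + z) / (S * X)) powr (2 * zeta) = ((r + z) / S / X) powr (2 * zeta)" by simp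
    moreover have "((r + z) / S / X) powr (2 * zeta) = ((r + z) / S) powr (2 * zeta) * X powr (- 2 * zeta)"
      using powr_minus_divide[of X "2 * zeta"] by (subst powr_divide) simp
    ultimately show ?thesis by (simp only:)
  qed
  have "((r + z) / S) powr (2 * zeta) * (t * M1 powr (- 1 - alpha) * X powr (- 2 * zeta))
      = t * M1 powr (- 1 - alpha) * (((r + z) / S) powr (2 * zeta) * X powr (- 2 * zeta))" by (simp only: mult_ac)
  also have "\<dots> \<le> K powr (1 + alpha) * ((t + \<tau>) * M3 powr (- 1 - alpha)) * ((1 + K) powr (2 * zeta) * Y powr (- 2 * zeta))"
    using pos by (intro mult_mono 1 2) auto
  also have "\<dots> = K powr (1 + alpha) * (1 + K) powr (2 * zeta) * ((t + \<tau>) * M3 powr (- 1 - alpha) * Y powr (- 2 * zeta))"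
    by (simp only: mult_ac)
  finally show ?thesis
    unfolding kernel_profile_def T[symmetric] M1_def[symmetric] M3_def[symmetric]
      S_def[symmetric] X_def[symmetric] Y_def[symmetric] K_def[symmetric] .
qed

theorem theorem3p1:
  fixes zeta alpha :: real
  assumes "0 \<le> zeta" and "0 < alpha" and "alpha < 2"
  shows "\<exists>C>0. \<forall>dens. (\<forall>t>0. stable_density alpha t (dens t)) \<longrightarrow>
    (\<forall>r s z t \<tau>. 0 < r \<longrightarrow> 0 < s \<longrightarrow> 0 < z \<longrightarrow> 0 < t \<longrightarrow> 0 < \<tau> \<longrightarrow>
       min (((r + z) / (r + s + z)) powr (2 * zeta) * p_alpha dens zeta t r z)
           (((s + z) / (r + s + z)) powr (2 * zeta) * p_alpha dens zeta \<tau> z s)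
         \<le> C * p_alpha dens zeta (t + \<tau>) r s
     \<and> p_alpha dens zeta t r z * p_alpha dens zeta \<tau> z s
         \<le> C * p_alpha dens zeta (t + \<tau>) r s *
            (((r + s + z) / (s + z)) powr (2 * zeta) * p_alpha dens zeta t r z
             + ((r + s + z) / (r + z)) powr (2 * zeta) * p_alpha dens zeta \<tau> z s))"
proof -
  obtain c0 C0 where b: "0 < c0" "0 < C0"
    "\<And>dens t r s. stable_density alpha t (dens t) \<Longrightarrow> 0 < t \<Longrightarrow> 0 < r \<Longrightarrow> 0 < s \<Longrightarrow>
       c0 * kernel_profile zeta alpha t r s \<le> p_alpha dens zeta t r s"
    "\<And>dens t r s. stable_density alpha t (dens t) \<Longrightarrow> 0 < t \<Longrightarrow> 0 < r \<Longrightarrow> 0 < s \<Longrightarrow>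
       p_alpha dens zeta t r s \<le> C0 * kernel_profile zeta alpha t r s"
    by (rule p_alpha_bounds[OF assms], rule that)
  define Q where "Q = (2 * 2 powr (1 / alpha)) powr (1 + alpha) * (1 + 2 * 2 powr (1 / alpha)) powr (2 * zeta)"
  have "0 < 1 + 2 * 2 powr (1 / alpha)" by (intro add_pos_pos mult_pos_pos) auto
  then have Q: "0 < Q" by (simp add: Q_def)
  \<comment> \<open>\<open>C0\<close> bounds the kernel on the left from above, \<open>Q\<close>
    compares the profiles, and \<open>c0\<close> bounds the kernel at time \<open>t + \<tau>\<close>
    from below.\<close>
  define C where "C = C0 * Q / c0"
  have C: "0 < C" using b Q by (simp add: C_def)
  have main: "min (((r + z) / (r + s + z)) powr (2 * zeta) * p_alpha dens zeta t r z)
           (((s + z) / (r + s + z)) powr (2 * zeta) * p_alpha dens zeta \<tau> z s)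
         \<le> C * p_alpha dens zeta (t + \<tau>) r s
     \<and> p_alpha dens zeta t r z * p_alpha dens zeta \<tau> z s
         \<le> C * p_alpha dens zeta (t + \<tau>) r s *
            (((r + s + z) / (s + z)) powr (2 * zeta) * p_alpha dens zeta t r z
             + ((r + s + z) / (r + z)) powr (2 * zeta) * p_alpha dens zeta \<tau> z s)"
    if d: "\<And>t. 0 < t \<Longrightarrow> stable_density alpha t (dens t)" and pos: "0 < r" "0 < s" "0 < z" "0 < t" "0 < \<tau>"
    for dens r s z t \<tau>
  proof -
    define p where "p = p_alpha dens zeta"
    define P where "P = p (t + \<tau>) r s"
    define W where "W a = ((a + z) / (r + s + z)) powr (2 * zeta)" for a
    define V where "V a = ((r + s + z) / (a + z)) powr (2 * zeta)" for a
    have VW: "V a * W a = 1" "0 < V a" if "0 < a" for a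
    proof -
      have "V a * W a = ((r + s + z) / (a + z) * ((a + z) / (r + s + z))) powr (2 * zeta)"
        unfolding V_def W_def using that pos by (subst powr_mult) auto
      also have "(r + s + z) / (a + z) * ((a + z) / (r + s + z)) = 1" using that pos by simp
      finally show "V a * W a = 1" by simp
      show "0 < V a" using that pos by (simp add: V_def)
    qed
    have W0: "0 \<le> W a" for a by (simp add: W_def)
    have lo: "c0 * kernel_profile zeta alpha t r s \<le> p t r s" if "0 < t" "0 < r" "0 < s" for t r s
      unfolding p_def using b(3)[of t dens r s] d that by simp
    have hi: "p t r s \<le> C0 * kernel_profile zeta alpha t r s" if "0 < t" "0 < r" "0 < s" for t r s
      unfolding p_def using b(4)[of t dens r s] d that by simp
    have p0: "0 \<le> p t r s" if "0 < t" "0 < r" "0 < s" for t r s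
      using lo[OF that] b(1) kernel_profile_nonneg[of t zeta alpha r s] that
      by (meson less_imp_le mult_nonneg_nonneg order_trans)
    have conv: "w * p t' x y \<le> C * P"
      if "0 < t'" "0 < x" "0 < y" "0 \<le> w"
        "w * kernel_profile zeta alpha t' x y \<le> Q * kernel_profile zeta alpha (t + \<tau>) r s"
      for w t' x y
    proof -
      have "w * p t' x y \<le> w * (C0 * kernel_profile zeta alpha t' x y)"
        using that hi[of t' x y] by (intro mult_left_mono) auto
      also have "\<dots> = C0 * (w * kernel_profile zeta alpha t' x y)" by simp
      also have "\<dots> \<le> C0 * (Q * kernel_profile zeta alpha (t + \<tau>) r s)" using that b by (intro mult_left_mono) auto
      also have "\<dots> = C * (c0 * kernel_profile zeta alpha (t + \<tau>) r s)" using b by (simp add: C_def)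
      also have "\<dots> \<le> C * P" unfolding P_def using lo[of "t + \<tau>" r s] pos C by (intro mult_left_mono) auto
      finally show ?thesis .
    qed
    have P0: "0 \<le> P" unfolding P_def using p0 pos by simp
    \<comment> \<open>Kept as a disjunction rather than as a minimum: the product inequality needs
      to know which factor is controlled.\<close>
    have cases: "W r * p t r z \<le> C * P \<or> W s * p \<tau> z s \<le> C * P"
    proof (cases "max \<bar>z - s\<bar> (\<tau> powr (1 / alpha)) \<le> max \<bar>r - z\<bar> (t powr (1 / alpha))")
      case True
      from kernel_profile_three_point[OF assms(1,2) pos True]
      have "W r * kernel_profile zeta alpha t r z \<le> Q * kernel_profile zeta alpha (t + \<tau>) r s"
        by (simp add: W_def Q_def)
      then show ?thesis using conv[of t r z "W r"] pos W0 by simp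
    next
      case False
      \<comment> \<open>The second leg is now the longer one; the three-point bound is applied with
        \<open>r\<close> and \<open>s\<close>, and \<open>t\<close> and \<open>\<tau>\<close>,
        exchanged.\<close>
      then have "max \<bar>z - r\<bar> (t powr (1 / alpha)) \<le> max \<bar>s - z\<bar> (\<tau> powr (1 / alpha))"
        by linarith
      from kernel_profile_three_point[OF assms(1,2) pos(2,1,3,5,4) this]
      have "W s * kernel_profile zeta alpha \<tau> z s \<le> Q * kernel_profile zeta alpha (t + \<tau>) r s"
        by (simp add: W_def Q_def add_ac kernel_profile_commute[of zeta alpha _ s])
      then show ?thesis using conv[of \<tau> z s "W s"] pos W0 by simp
    qed
    have first: "min (W r * p t r z) (W s * p \<tau> z s) \<le> C * P" using cases by auto
    have p1: "0 \<le> p t r z" "0 \<le> p \<tau> z s" using p0 pos by auto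
    \<comment> \<open>The controlled factor is replaced by its bound, with the weight inverted
      through \<open>V a * W a = 1\<close>, and the other factor is kept. This yields one summand on
      the right, with the weights placed crosswise; the other summand is nonnegative.\<close>
    have "p t r z * p \<tau> z s \<le> C * P * (V s * p t r z + V r * p \<tau> z s)"
      using cases
    proof
      assume h: "W r * p t r z \<le> C * P"
      have "p t r z = V r * (W r * p t r z)" using VW(1)[OF pos(1)] by (simp flip: mult.assoc)
      also have "\<dots> \<le> V r * (C * P)" using h VW(2)[OF pos(1)] by (intro mult_left_mono) auto
      finally have "p t r z * p \<tau> z s \<le> V r * (C * P) * p \<tau> z s" using p1 by (intro mult_right_mono)
      also have "\<dots> = C * P * (V r * p \<tau> z s)" by simp
      also have "\<dots> \<le> C * P * (V s * p t r z + V r * p \<tau> z s)"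
        using p1 VW(2)[OF pos(2)] C P0 by (intro mult_left_mono) auto
      finally show ?thesis .
    next
      assume h: "W s * p \<tau> z s \<le> C * P"
      have "p \<tau> z s = V s * (W s * p \<tau> z s)" using VW(1)[OF pos(2)] by (simp flip: mult.assoc)
      also have "\<dots> \<le> V s * (C * P)" using h VW(2)[OF pos(2)] by (intro mult_left_mono) auto
      finally have "p t r z * p \<tau> z s \<le> p t r z * (V s * (C * P))" using p1 by (intro mult_left_mono)
      also have "\<dots> = C * P * (V s * p t r z)" by simp
      also have "\<dots> \<le> C * P * (V s * p t r z + V r * p \<tau> z s)"
        using p1 VW(2)[OF pos(1)] C P0 by (intro mult_left_mono) auto
      finally show ?thesis .
    qed
    with first show ?thesis unfolding P_def W_def V_def p_def by blast
  qed
  show ?thesis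
    by (rule exI[of _ C], rule conjI[OF C], intro allI impI, rule main) auto
qed

end
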